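(* Let $n\ge12$ and $2\le k\le n/2-1$ be positive integers and let $f:\mathbb N\to\mathbb N$ satisfy $f(n)=\omega(\sqrt n)$. Let $\mathcal C_{2k+1}=\mathcal C_{2k+1}(n)$ be the family of all $(2k+1)$-edge-connected graphs on $[n]$. Then with high probability $$\left(k+1-1/e\right)n-f(n)\le \tau(\mathcal C_{2k+1},n)\le \left(k+1-1/e\right)n+f(n)+2k,$$ where the upper bound is claimed under the additional assumption $k=o(n)$.
   Context: Semi-random no-replacement multigraph process on $[n]=\{1,\dots,n\}$: let $\pi_1,\pi_2,\dots$ be independent uniformly random permutations in $S_n$. Builder's multigraph starts empty on $[n]$. In round $k\ge1$ Builder is offered the vertex $v_k:=\pi_{\lceil k/n\rceil}(k-\lfloor (k-1)/n\rfloor n)$; Builder then chooses a vertex $u_k$ according to his strategy (a rule depending on the history so far) and adds the edge $u_kv_k$ (multiple edges allowed). For a family $\mathcal F$ of labeled graphs on $[n]$ and a strategy $\mathcal S$, $\tau(\mathcal S)$ is the least $m$ such that Builder's multigraph after $m$ rounds contains some member of $\mathcal F$ as a subgraph. $\tau(\mathcal F,n)$ (for a family closed under isomorphism) is a random variable with $\Pr(\tau(\mathcal F,n)\le k)=\max_{\mathcal S}\Pr(\tau(\mathcal S)\le k)$ for all $k\ge0$. W.h.p. means with probability tending to $1$ as $n\to\infty$. *)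

theory Defs
  imports "HOL-Probability.Probability" "HOL-Library.Landau_Symbols"
begin

text \<open>A labeled (simple) graph on \<open>[n]\<close> is identified with its edge set.\<close>

definition labeled_graph :: "nat \<Rightarrow> nat set set \<Rightarrow> bool" where
  "labeled_graph n E \<longleftrightarrow> (\<forall>e\<in>E. e \<subseteq> {1..n} \<and> card e = 2)"

definition connected_graph :: "nat \<Rightarrow> nat set set \<Rightarrow> bool" where
  "connected_graph n E \<longleftrightarrow> (\<forall>u\<in>{1..n}. \<forall>v\<in>{1..n}. (u, v) \<in> {(x, y). {x, y} \<in> E}\<^sup>*)"

definition edge_connected :: "nat \<Rightarrow> nat \<Rightarrow> nat set set \<Rightarrow> bool" where
  "edge_connected n l E \<longleftrightarrow> n \<ge> 2 \<and>
     (\<forall>D. D \<subseteq> E \<and> card D < l \<longrightarrow> connected_graph n (E - D))"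

definition edge_connected_family :: "nat \<Rightarrow> nat \<Rightarrow> nat set set set" where
  "edge_connected_family n l = {E. labeled_graph n E \<and> edge_connected n l E}"


definition perm_space :: "nat \<Rightarrow> (nat \<Rightarrow> nat \<Rightarrow> nat) measure" where
  "perm_space n = PiM {1..} (\<lambda>_. uniform_count_measure {p. p permutes {1..n}})"

text \<open>For \<open>j \<ge> 1\<close>, the ceiling of \<open>j / n\<close> is \<open>(j - 1) div n + 1\<close>.\<close>

definition offered :: "nat \<Rightarrow> (nat \<Rightarrow> nat \<Rightarrow> nat) \<Rightarrow> nat \<Rightarrow> nat" where
  "offered n \<pi> j = \<pi> ((j - 1) div n + 1) (j - ((j - 1) div n) * n)"

text \<open>
  A strategy maps the list of pairs (offered vertex, chosen vertex) of the earlier rounds and the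
  vertex offered in the current round to the vertex that Builder chooses.
\<close>

type_synonym strategy = "(nat \<times> nat) list \<Rightarrow> nat \<Rightarrow> nat"

definition strategies :: "nat \<Rightarrow> strategy set" where
  "strategies n = {S. \<forall>h v. S h v \<in> {1..n}}"

primrec history :: "nat \<Rightarrow> strategy \<Rightarrow> (nat \<Rightarrow> nat \<Rightarrow> nat) \<Rightarrow> nat \<Rightarrow> (nat \<times> nat) list" where
  "history n S \<pi> 0 = []"
| "history n S \<pi> (Suc m) =
     (let h = history n S \<pi> m; v = offered n \<pi> (Suc m) in h @ [(v, S h v)])"

definition builder_multigraph ::
    "nat \<Rightarrow> strategy \<Rightarrow> (nat \<Rightarrow> nat \<Rightarrow> nat) \<Rightarrow> nat \<Rightarrow> nat set multiset" where
  "builder_multigraph n S \<pi> m = mset (map (\<lambda>(v, u). {u, v}) (history n S \<pi> m))"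

text \<open>The value is \<open>\<infinity>\<close> if no member of the family is ever contained in Builder's multigraph.\<close>

definition hitting_time ::
    "nat \<Rightarrow> nat set set set \<Rightarrow> strategy \<Rightarrow> (nat \<Rightarrow> nat \<Rightarrow> nat) \<Rightarrow> enat" where
  "hitting_time n \<F> S \<pi> =
     Inf {enat m | m. \<exists>E\<in>\<F>. E \<subseteq> set_mset (builder_multigraph n S \<pi> m)}"

definition success_prob :: "nat \<Rightarrow> nat set set set \<Rightarrow> strategy \<Rightarrow> nat \<Rightarrow> real" where
  "success_prob n \<F> S m =
     measure (perm_space n) {\<pi> \<in> space (perm_space n). hitting_time n \<F> S \<pi> \<le> enat m}"

text \<open>
  \<open>T\<close>, defined on the probability space \<open>M\<close>, is a version of \<open>\<tau>(\<F>, n)\<close>. The set under \<open>MAX\<close> is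
  finite and, for \<open>n \<ge> 1\<close>, nonempty; a version exists for every \<open>\<F>\<close> and \<open>n \<ge> 1\<close>. Both facts are
  proved below.
\<close>

definition is_tau :: "nat \<Rightarrow> nat set set set \<Rightarrow> 'a measure \<Rightarrow> ('a \<Rightarrow> enat) \<Rightarrow> bool" where
  "is_tau n \<F> M T \<longleftrightarrow> prob_space M \<and> T \<in> M \<rightarrow>\<^sub>M count_space UNIV \<and>
     (\<forall>m. measure M {\<omega> \<in> space M. T \<omega> \<le> enat m} = (MAX S\<in>strategies n. success_prob n \<F> S m))"


lemma prob_space_perm_space: "prob_space (perm_space n)"
proof -
  have "finite {p. p permutes {1..n}}" "{p. p permutes {1..n}} \<noteq> {}"
    using permutes_id[of "{1..n}"] finite_permutations[of "{1..n}"] by blast+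
  then show ?thesis
    unfolding perm_space_def by (intro prob_space_PiM prob_space_uniform_count_measure)
qed

lemma strategies_nonempty: "n \<ge> 1 \<Longrightarrow> strategies n \<noteq> {}"
  by (auto simp: strategies_def intro!: exI[of _ "\<lambda>_ _. 1"])

lemma Inf_enat_le_iff: "Inf {enat m | m. P m} \<le> enat m \<longleftrightarrow> (\<exists>i\<le>m. P i)" (is "?L \<longleftrightarrow> ?R")
proof
  let ?A = "{enat m | m. P m}"
  assume L: ?L
  have "?A \<noteq> {}"
  proof
    assume "?A = {}"
    then have "Inf ?A = \<infinity>" by (simp add: Inf_enat_def)
    with L show False by simp
  qed
  then have "Inf ?A \<in> ?A"
    unfolding Inf_enat_def by (metis (no_types, lifting) LeastI_ex ex_in_conv)
  then obtain i where "Inf ?A = enat i" "P i"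
    by auto
  with L show ?R
    by auto
next
  assume ?R
  then obtain i where i: "i \<le> m" "P i"
    by auto
  then have "Inf {enat m | m. P m} \<le> enat i"
    by (intro Inf_lower) auto
  with i show ?L
    by (meson enat_ord_simps(1) order_trans)
qed

lemma hitting_time_le_iff:
  "hitting_time n \<F> S \<pi> \<le> enat m \<longleftrightarrow>
     (\<exists>i\<le>m. \<exists>E\<in>\<F>. E \<subseteq> set_mset (builder_multigraph n S \<pi> i))"
  unfolding hitting_time_def by (rule Inf_enat_le_iff)

lemma offered_in:
  assumes "n \<ge> 1" "j \<ge> 1" "\<pi> \<in> space (perm_space n)"
  shows "offered n \<pi> j \<in> {1..n}"
proof -
  have "\<pi> ((j - 1) div n + 1) permutes {1..n}"
    using assms(3) by (auto simp: perm_space_def space_PiM PiE_def space_uniform_count_measure)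
  moreover have "j - ((j - 1) div n) * n = Suc ((j - 1) mod n)"
    using assms(2) div_mult_mod_eq[of "j - 1" n] by linarith
  then have "j - ((j - 1) div n) * n \<in> {1..n}"
    using assms(1) by (simp add: Suc_le_eq)
  ultimately show ?thesis
    unfolding offered_def using permutes_in_image by metis
qed

lemma length_history [simp]: "length (history n S \<pi> m) = m"
  by (induction m) (auto simp: Let_def)

lemma set_history:
  assumes "n \<ge> 1" "S \<in> strategies n" "\<pi> \<in> space (perm_space n)"
  shows "set (history n S \<pi> m) \<subseteq> {1..n} \<times> {1..n}"
proof (induction m)
  case (Suc m)
  have "offered n \<pi> (Suc m) \<in> {1..n}"
    using assms by (intro offered_in) auto
  with Suc assms(2) show ?case
    by (auto simp: Let_def strategies_def)
qed auto

lemma history_cong: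
  assumes "n \<ge> 1" "S \<in> strategies n" "\<pi> \<in> space (perm_space n)"
    and eq: "\<And>h v. set h \<subseteq> {1..n} \<times> {1..n} \<Longrightarrow> length h \<le> m \<Longrightarrow> v \<in> {1..n} \<Longrightarrow> S h v = S' h v"
    and "i \<le> m"
  shows "history n S \<pi> i = history n S' \<pi> i"
  using \<open>i \<le> m\<close>
proof (induction i)
  case (Suc i)
  have "offered n \<pi> (Suc i) \<in> {1..n}"
    using assms by (intro offered_in) auto
  moreover have "set (history n S \<pi> i) \<subseteq> {1..n} \<times> {1..n}"
    using assms by (intro set_history)
  ultimately have "S (history n S \<pi> i) (offered n \<pi> (Suc i)) =
      S' (history n S \<pi> i) (offered n \<pi> (Suc i))"
    using Suc.prems by (intro eq) auto
  with Suc show ?case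
    by (simp add: Let_def)
qed auto

lemma finite_success_probs:
  assumes "n \<ge> 1"
  shows "finite ((\<lambda>S. success_prob n \<F> S m) ` strategies n)"
proof -
  define H where "H = {h. set h \<subseteq> {1..n} \<times> {1..n} \<and> length h \<le> m} \<times> {1..n}"
  define r where "r = (\<lambda>S::strategy. restrict (case_prod S) H)"
  have "finite H"
    unfolding H_def by (intro finite_cartesian_product finite_lists_length_le) auto
  then have "finite (PiE H (\<lambda>_. {1..n}))"
    by (intro finite_PiE) auto
  moreover have "r ` strategies n \<subseteq> PiE H (\<lambda>_. {1..n})"
    by (auto simp: r_def strategies_def)
  ultimately have fin: "finite (r ` strategies n)"
    by (rule finite_subset[rotated])
  have same: "success_prob n \<F> S m = success_prob n \<F> S' m"
    if S: "S \<in> strategies n" and eq: "r S = r S'" for S S'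
  proof -
    have "S h v = S' h v" if "set h \<subseteq> {1..n} \<times> {1..n}" "length h \<le> m" "v \<in> {1..n}" for h v
    proof -
      have "r S (h, v) = r S' (h, v)" by (simp add: eq)
      with that show ?thesis by (simp add: r_def H_def)
    qed
    then have "history n S \<pi> i = history n S' \<pi> i" if "\<pi> \<in> space (perm_space n)" "i \<le> m" for \<pi> i
      using that assms S by (intro history_cong[where m = m]) auto
    then have "{\<pi> \<in> space (perm_space n). hitting_time n \<F> S \<pi> \<le> enat m} =
        {\<pi> \<in> space (perm_space n). hitting_time n \<F> S' \<pi> \<le> enat m}"
      unfolding hitting_time_le_iff builder_multigraph_def by (metis (no_types, lifting))
    then show ?thesis
      by (simp add: success_prob_def)
  qed
  have "(\<lambda>S. success_prob n \<F> S m) ` strategies n \<subseteq>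
      (\<lambda>g. success_prob n \<F> (inv_into (strategies n) r g) m) ` (r ` strategies n)"
  proof
    fix x assume "x \<in> (\<lambda>S. success_prob n \<F> S m) ` strategies n"
    then obtain S where S: "S \<in> strategies n" "x = success_prob n \<F> S m" by auto
    have "r (inv_into (strategies n) r (r S)) = r S"
      by (rule f_inv_into_f[where f = r]) (rule imageI, rule S)
    then have "x = success_prob n \<F> (inv_into (strategies n) r (r S)) m"
      unfolding S(2) by (intro same S(1)) (rule sym)
    with S show "x \<in> (\<lambda>g. success_prob n \<F> (inv_into (strategies n) r g) m) ` (r ` strategies n)"
      by blast
  qed
  then show ?thesis
    using fin by (meson finite_imageI finite_subset)
qed

lemma measurable_offered: "(\<lambda>\<pi>. offered n \<pi> j) \<in> perm_space n \<rightarrow>\<^sub>M count_space UNIV"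
proof -
  have "(\<lambda>p. p i) \<in> uniform_count_measure {p. p permutes {1..n}} \<rightarrow>\<^sub>M count_space UNIV" for i
    by (auto simp: measurable_def sets_uniform_count_measure space_uniform_count_measure)
  moreover have "(\<lambda>\<pi>. \<pi> q) \<in> perm_space n \<rightarrow>\<^sub>M uniform_count_measure {p. p permutes {1..n}}"
    if "q \<ge> 1" for q
    unfolding perm_space_def using that by (intro measurable_component_singleton) auto
  ultimately show ?thesis
    unfolding offered_def by (rule measurable_compose[rotated]) auto
qed

lemma measurable_history: "(\<lambda>\<pi>. history n S \<pi> m) \<in> perm_space n \<rightarrow>\<^sub>M count_space UNIV"
proof (induction m)
  case (Suc m)
  have "(\<lambda>\<pi>. (\<lambda>h \<pi>. h @ [(offered n \<pi> (Suc m), S h (offered n \<pi> (Suc m)))]) (history n S \<pi> m) \<pi>)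
      \<in> perm_space n \<rightarrow>\<^sub>M count_space UNIV"
  proof (rule measurable_compose_countable[OF _ Suc])
    fix h
    show "(\<lambda>\<pi>. h @ [(offered n \<pi> (Suc m), S h (offered n \<pi> (Suc m)))])
        \<in> perm_space n \<rightarrow>\<^sub>M count_space UNIV"
      by (rule measurable_compose[OF measurable_offered, where g = "\<lambda>v. h @ [(v, S h v)]"]) auto
  qed
  then show ?case
    by (simp add: Let_def)
qed auto

lemma success_event_measurable:
  "{\<pi> \<in> space (perm_space n). hitting_time n \<F> S \<pi> \<le> enat m} \<in> sets (perm_space n)"
proof -
  have "Measurable.pred (perm_space n) (\<lambda>\<pi>. \<exists>E\<in>\<F>. E \<subseteq> set_mset (builder_multigraph n S \<pi> i))" for i
    unfolding builder_multigraph_def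
    by (rule measurable_compose[OF measurable_history,
          where g = "\<lambda>h. \<exists>E\<in>\<F>. E \<subseteq> set_mset (mset (map (\<lambda>(v, u). {u, v}) h))"]) auto
  then show ?thesis
    unfolding hitting_time_le_iff by measurable
qed

lemma success_prob_mono:
  assumes "m \<le> m'"
  shows "success_prob n \<F> S m \<le> success_prob n \<F> S m'"
proof -
  interpret prob_space "perm_space n" by (rule prob_space_perm_space)
  show ?thesis
    unfolding success_prob_def using assms
    by (intro finite_measure_mono success_event_measurable) (auto intro: order_trans)
qed

lemma is_tau_exists:
  assumes "n \<ge> 1"
  shows "\<exists>(M :: real measure) T. is_tau n \<F> M T"
proof -
  define p where "p m = (MAX S\<in>strategies n. success_prob n \<F> S m)" for m
  have ne: "(\<lambda>S. success_prob n \<F> S m) ` strategies n \<noteq> {}" for m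
    using strategies_nonempty[OF assms] by auto
  have p_in: "\<exists>S\<in>strategies n. p m = success_prob n \<F> S m" for m
    using Max_in[OF finite_success_probs[OF assms] ne] unfolding p_def by blast
  have p_ge: "success_prob n \<F> S m \<le> p m" if "S \<in> strategies n" for S m
    using finite_success_probs[OF assms] that unfolding p_def by (intro Max_ge) auto
  have p01: "0 \<le> p m" "p m \<le> 1" for m
    using p_in[of m] prob_space.prob_le_1[OF prob_space_perm_space]
    by (auto simp: success_prob_def)
  have p_mono: "p m \<le> p m'" if "m \<le> m'" for m m'
    using p_in[of m] p_ge[of _ m'] success_prob_mono[OF that] by (metis order_trans)
  define M where "M = uniform_measure lborel {0..1::real}"
  define T where "T x = Inf {enat m | m. x \<le> p m}" for x
  have T_le: "T x \<le> enat m \<longleftrightarrow> x \<le> p m" for x m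
    unfolding T_def Inf_enat_le_iff using p_mono by (meson order_refl order_trans)
  have pM: "prob_space M"
    unfolding M_def by (intro prob_space_uniform_measure) auto
  have [measurable_cong]: "sets M = sets borel"
    by (simp add: M_def)
  have "T \<in> M \<rightarrow>\<^sub>M count_space UNIV"
  proof -
    have le: "{x \<in> space M. T x \<le> enat m} \<in> sets M" for m
      unfolding T_le by measurable
    have "T -` {a} \<inter> space M \<in> sets M" for a
    proof (cases a)
      case (enat m)
      have "T -` {a} \<inter> space M =
          {x \<in> space M. T x \<le> enat m} - (\<Union>i\<in>{..<m}. {x \<in> space M. T x \<le> enat i})"
      proof -
        have "t = enat m \<longleftrightarrow> t \<le> enat m \<and> (\<forall>i<m. \<not> t \<le> enat i)" for t
          by (cases t) (auto simp: not_le intro: le_antisym, meson le_neq_implies_less less_irrefl)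
        then show ?thesis unfolding enat by blast
      qed
      with le show ?thesis by auto
    next
      case infinity
      have "T -` {a} \<inter> space M = space M - (\<Union>i. {x \<in> space M. T x \<le> enat i})"
      proof -
        have "t = \<infinity> \<longleftrightarrow> (\<forall>i. \<not> t \<le> enat i)" for t :: enat
          by (cases t) auto
        from this[of "T _"] show ?thesis unfolding infinity by (intro set_eqI) auto
      qed
      with le show ?thesis by auto
    qed
    then show ?thesis
      by (subst measurable_count_space_eq2_countable) auto
  qed
  moreover have "measure M {x \<in> space M. T x \<le> enat m} = p m" for m
  proof -
    have "{0..1} \<inter> {x. x \<le> p m} = {0..p m}"
      using p01[of m] by auto
    then show ?thesis
      unfolding T_le M_def using p01[of m]
      by (subst measure_uniform_measure) auto
  qed
  ultimately show ?thesis
    using pM unfolding is_tau_def p_def by blast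
qed

end

theory Submission
  imports Defs
begin

text \<open>
  After the first \<open>k n\<close> rounds the degrees sum to \<open>2 k n\<close>, so for minimum degree \<open>2 k + 1\<close> a total
  deficit of at least \<open>n\<close> is left. In round \<open>i + 1\<close> of the next permutation the choice of Builder
  lowers the deficit \<open>X\<close> by at most one, and the offered vertex, uniform among the \<open>n - i\<close> remaining
  ones, lowers it by one more with probability at most \<open>X / (n - i)\<close>. Hence
  \<open>X / (n - i) + (\<Sum>j<i. 1 / (n - j - 1))\<close> is a submartingale with increments of order \<open>1 / n\<close>; a
  second moment bound keeps \<open>X\<close> positive until \<open>ln (n / (n - i))\<close> is close to 1, that is, until
  \<open>i\<close> is within \<open>O (sqrt n)\<close> of \<open>(1 - 1 / e) n\<close>.

  Conversely, in block \<open>j \<le> k\<close> Builder joins the offered vertex \<open>v\<close> to \<open>v + j\<close> modulo \<open>n\<close>. For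
  \<open>k \<ge> 2\<close> all cuts of the resulting circulant graph with at least two vertices on either side have
  more than \<open>2 k\<close> edges, so it remains to give every vertex one new edge. Builder does so greedily;
  he can be blocked only when at most \<open>2 k + 1\<close> vertices are left, and then only with probability
  \<open>O (k / n)\<close> per round, which costs less than the extra \<open>2 k\<close> rounds.
\<close>

section \<open>Exposing a uniform permutation value by value\<close>

text \<open>The permutations are independent and uniform on a finite set, so the event is an
  embedded finite product and its measure factorizes. Later estimates reduce to counting
  permutations through this formula.\<close>

lemma perm_space_cylinder:
  assumes "finite J" "J \<subseteq> {1..}" and X: "\<And>j. j \<in> J \<Longrightarrow> X j \<subseteq> {p. p permutes {1..n}}"
  shows "{\<pi> \<in> space (perm_space n). \<forall>j\<in>J. \<pi> j \<in> X j} \<in> sets (perm_space n)"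
    and "measure (perm_space n) {\<pi> \<in> space (perm_space n). \<forall>j\<in>J. \<pi> j \<in> X j} =
           (\<Prod>j\<in>J. real (card (X j)) / fact n)"
proof -
  let ?P = "{p. p permutes {1..n}}"
  have fin: "finite ?P" and ne: "?P \<noteq> {}" and card: "card ?P = fact n"
    using permutes_id[of "{1..n}"] finite_permutations[of "{1..n}"]
    by (blast, blast, simp add: card_permutations)
  interpret product_prob_space "\<lambda>_. uniform_count_measure ?P" "{1..}"
    by (intro product_prob_spaceI prob_space_uniform_count_measure fin ne)
  let ?A = "prod_emb {1..} (\<lambda>_. uniform_count_measure ?P) J (Pi\<^sub>E J X)"
  have eq: "{\<pi> \<in> space (perm_space n). \<forall>j\<in>J. \<pi> j \<in> X j} = ?A"
    using assms(2) unfolding perm_space_def prod_emb_def space_PiM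
    by (auto simp: space_uniform_count_measure PiE_iff Int_def restrict_def extensional_def)
  have "?A \<in> sets (perm_space n)"
    unfolding perm_space_def using assms
    by (intro sets_PiM_I) (auto simp: sets_uniform_count_measure)
  then show "{\<pi> \<in> space (perm_space n). \<forall>j\<in>J. \<pi> j \<in> X j} \<in> sets (perm_space n)"
    by (simp add: eq)
  have "measure (perm_space n) ?A = (\<Prod>j\<in>J. measure (uniform_count_measure ?P) (X j))"
    unfolding perm_space_def using assms
    by (intro measure_PiM_emb) (auto simp: sets_uniform_count_measure)
  also have "\<dots> = (\<Prod>j\<in>J. real (card (X j)) / fact n)"
    using X by (intro prod.cong refl, subst measure_uniform_count_measure[OF fin]) (auto simp: card[simplified])
  finally show "measure (perm_space n) {\<pi> \<in> space (perm_space n). \<forall>j\<in>J. \<pi> j \<in> X j} =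
           (\<Prod>j\<in>J. real (card (X j)) / fact n)"
    by (simp add: eq)
qed

text \<open>Law of total probability over the finitely many values \<open>a\<close> of the first
  \<open>k\<close> permutations. A bound valid for every such past holds unconditionally, so both
  halves of the theorem only have to count single permutations after a fixed history.\<close>

lemma perm_space_conditional_bound:
  fixes Q :: "(nat \<Rightarrow> nat \<Rightarrow> nat) \<Rightarrow> (nat \<Rightarrow> nat) \<Rightarrow> bool"
  assumes bound: "\<And>a. a \<in> {1..k} \<rightarrow>\<^sub>E {p. p permutes {1..n}} \<Longrightarrow>
      real (card {p. p permutes {1..n} \<and> Q a p}) \<le> \<delta> * fact n"
  shows "{\<pi> \<in> space (perm_space n). Q (restrict \<pi> {1..k}) (\<pi> (Suc k))} \<in> sets (perm_space n)"
    and "measure (perm_space n)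
           {\<pi> \<in> space (perm_space n). Q (restrict \<pi> {1..k}) (\<pi> (Suc k))} \<le> \<delta>"
proof -
  let ?P = "{p. p permutes {1..n}}"
  let ?A = "{1..k} \<rightarrow>\<^sub>E ?P"
  interpret prob_space "perm_space n" by (rule prob_space_perm_space)
  have fin: "finite ?P" and card: "card ?P = fact n"
    using finite_permutations[of "{1..n}"] by (blast, simp add: card_permutations)
  have finA: "finite ?A"
    using fin by (intro finite_PiE) auto
  \<comment> \<open>The cylinder fixes the first \<open>k\<close> permutations to \<open>a\<close>
    and lets the next one range over those satisfying \<open>Q a\<close>.\<close>
  define X where "X a = (\<lambda>j. if j = Suc k then {p \<in> ?P. Q a p} else {a j})" for a
  define C where "C a = {\<pi> \<in> space (perm_space n). \<forall>j\<in>{1..Suc k}. \<pi> j \<in> X a j}" for a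
  have X: "X a j \<subseteq> ?P" if "a \<in> ?A" "j \<in> {1..Suc k}" for a j
    using that by (auto simp: X_def PiE_iff)
  have C_sets: "C a \<in> sets (perm_space n)" if "a \<in> ?A" for a
    unfolding C_def using X[OF that] by (intro perm_space_cylinder) auto
  have C_le: "measure (perm_space n) (C a) \<le> (1 / fact n) ^ k * \<delta>" if a: "a \<in> ?A" for a
  proof -
    have "measure (perm_space n) (C a) = (\<Prod>j\<in>{1..Suc k}. real (card (X a j)) / fact n)"
      unfolding C_def using X[OF a] by (intro perm_space_cylinder) auto
    also have "{1..Suc k} = insert (Suc k) {1..k}" by auto
    also have "(\<Prod>j\<in>insert (Suc k) {1..k}. real (card (X a j)) / fact n) =
        real (card {p \<in> ?P. Q a p}) / fact n * (\<Prod>j\<in>{1..k}. real (card (X a j)) / fact n)"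
      by (simp add: X_def)
    also have "(\<Prod>j\<in>{1..k}. real (card (X a j)) / fact n) = (\<Prod>j\<in>{1..k}. 1 / fact n)"
      by (intro prod.cong) (auto simp: X_def)
    also have "\<dots> = (1 / fact n) ^ k" by simp
    also have "real (card {p \<in> ?P. Q a p}) / fact n * (1 / fact n) ^ k \<le> \<delta> * (1 / fact n) ^ k"
      using bound[OF a] by (intro mult_right_mono) (simp_all add: field_simps)
    finally show ?thesis by (simp add: mult.commute)
  qed
  have eq: "{\<pi> \<in> space (perm_space n). Q (restrict \<pi> {1..k}) (\<pi> (Suc k))} = (\<Union>a\<in>?A. C a)"
    (is "?L = ?R")
  proof (intro equalityI subsetI)
    fix \<pi> assume \<pi>: "\<pi> \<in> ?L"
    then have perm: "\<pi> j \<in> ?P" if "j \<ge> 1" for j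
      using that by (auto simp: perm_space_def space_PiM PiE_iff space_uniform_count_measure)
    then have "restrict \<pi> {1..k} \<in> ?A" by auto
    moreover have "\<pi> \<in> C (restrict \<pi> {1..k})"
      using \<pi> perm[of "Suc k"] by (auto simp: C_def X_def)
    ultimately show "\<pi> \<in> ?R" by blast
  next
    fix \<pi> assume "\<pi> \<in> ?R"
    then obtain a where a: "a \<in> ?A" "\<pi> \<in> C a" by blast
    have "\<pi> j = a j" if "j \<in> {1..k}" for j
      using a(2) that by (auto simp: C_def X_def dest!: bspec[of _ _ j])
    then have "restrict \<pi> {1..k} = a"
      using a(1) by (intro ext) (auto simp: PiE_iff extensional_def)
    moreover have "Q a (\<pi> (Suc k))"
      using a(2) by (auto simp: C_def X_def dest!: bspec[of _ _ "Suc k"])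
    ultimately show "\<pi> \<in> ?L"
      using a(2) by (simp add: C_def)
  qed
  show "{\<pi> \<in> space (perm_space n). Q (restrict \<pi> {1..k}) (\<pi> (Suc k))} \<in> sets (perm_space n)"
    unfolding eq using finA C_sets by (intro sets.finite_UN) auto
  have "measure (perm_space n) (\<Union>a\<in>?A. C a) \<le> (\<Sum>a\<in>?A. measure (perm_space n) (C a))"
    using finA C_sets by (intro finite_measure_subadditive_finite) auto
  also have "\<dots> \<le> (\<Sum>a\<in>?A. (1 / fact n) ^ k * \<delta>)"
    by (intro sum_mono C_le)
  also have "\<dots> = \<delta>"
    using card by (simp add: card_PiE power_divide)
  finally show "measure (perm_space n)
      {\<pi> \<in> space (perm_space n). Q (restrict \<pi> {1..k}) (\<pi> (Suc k))} \<le> \<delta>"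
    unfolding eq .
qed

definition perm_prefix :: "(nat \<Rightarrow> nat) \<Rightarrow> nat \<Rightarrow> nat list" where
  "perm_prefix p i = map p [1..<Suc i]"

lemma perm_prefix_Suc: "perm_prefix p (Suc i) = perm_prefix p i @ [p (Suc i)]"
  by (simp add: perm_prefix_def)

lemma perm_prefix_0 [simp]: "perm_prefix p 0 = []"
  by (simp add: perm_prefix_def)

lemma length_perm_prefix [simp]: "length (perm_prefix p i) = i"
  by (simp add: perm_prefix_def)

lemma perm_prefix_props:
  assumes "p permutes {1..n}" "i \<le> n"
  shows "distinct (perm_prefix p i)" "set (perm_prefix p i) \<subseteq> {1..n}"
    and "{1..n} - set (perm_prefix p i) = p ` {Suc i..n}"
proof -
  show "distinct (perm_prefix p i)"
    using permutes_inj_on[OF assms(1)] by (simp add: perm_prefix_def distinct_map)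
  show "set (perm_prefix p i) \<subseteq> {1..n}"
    using assms permutes_in_image[OF assms(1)] by (fastforce simp: perm_prefix_def)
  have "{1..n} - set (perm_prefix p i) = p ` {1..n} - p ` {1..i}"
    using permutes_image[OF assms(1)] by (simp add: perm_prefix_def atLeastLessThanSuc_atLeastAtMost del: upt_Suc)
  also have "\<dots> = p ` ({1..n} - {1..i})"
    using permutes_inj_on[OF assms(1)] assms(2) by (subst inj_on_image_set_diff[where C = UNIV]) auto
  also have "{1..n} - {1..i} = {Suc i..n}" by auto
  finally show "{1..n} - set (perm_prefix p i) = p ` {Suc i..n}" .
qed

text \<open>Exchanging the values at positions \<open>i + 1\<close> and \<open>j > i\<close> does not change the first \<open>i\<close> values,
  so the next value is uniformly distributed over those not seen yet.\<close>

lemma sum_permutations_next: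
  fixes V :: "nat list \<Rightarrow> real"
  assumes "i < n"
  shows "(\<Sum>p | p permutes {1..n}. V (perm_prefix p (Suc i))) =
    (\<Sum>p | p permutes {1..n}. (\<Sum>v\<in>{1..n} - set (perm_prefix p i). V (perm_prefix p i @ [v])) / real (n - i))"
proof -
  let ?P = "{p. p permutes {1..n}}"
  have swap: "(\<Sum>p\<in>?P. V (perm_prefix p (Suc i))) = (\<Sum>p\<in>?P. V (perm_prefix p i @ [p j]))"
    if j: "j \<in> {Suc i..n}" for j
  proof (rule sum.reindex_bij_witness[where i = "\<lambda>p. p \<circ> Transposition.transpose (Suc i) j"
        and j = "\<lambda>p. p \<circ> Transposition.transpose (Suc i) j"])
    fix p assume "p \<in> ?P"
    then show "p \<circ> Transposition.transpose (Suc i) j \<in> ?P"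
      using j assms by (auto intro!: permutes_compose permutes_swap_id)
    then show "p \<circ> Transposition.transpose (Suc i) j \<in> ?P" .
    have "perm_prefix (p \<circ> Transposition.transpose (Suc i) j) i = perm_prefix p i"
      unfolding perm_prefix_def using j by (intro map_cong) (auto simp: transpose_apply_other)
    then show "V (perm_prefix (p \<circ> Transposition.transpose (Suc i) j) i @ [(p \<circ> Transposition.transpose (Suc i) j) j]) =
        V (perm_prefix p (Suc i))"
      by (simp only: perm_prefix_Suc comp_apply transpose_apply_second)
  qed (auto simp: comp_assoc)
  \<comment> \<open>The value at position i + 1 may be replaced by the value at any of the n - i
    positions \<open>j\<close>; these identities are averaged over \<open>j\<close>.\<close>
  have "real (n - i) * (\<Sum>p\<in>?P. V (perm_prefix p (Suc i))) =
      (\<Sum>j\<in>{Suc i..n}. \<Sum>p\<in>?P. V (perm_prefix p (Suc i)))"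
    by simp
  also have "\<dots> = (\<Sum>j\<in>{Suc i..n}. \<Sum>p\<in>?P. V (perm_prefix p i @ [p j]))"
    by (intro sum.cong swap refl)
  also have "\<dots> = (\<Sum>p\<in>?P. \<Sum>j\<in>{Suc i..n}. V (perm_prefix p i @ [p j]))"
    by (rule sum.swap)
  also have "\<dots> = (\<Sum>p\<in>?P. \<Sum>v\<in>{1..n} - set (perm_prefix p i). V (perm_prefix p i @ [v]))"
  proof (rule sum.cong[OF refl])
    fix p assume "p \<in> ?P"
    then show "(\<Sum>j\<in>{Suc i..n}. V (perm_prefix p i @ [p j])) =
        (\<Sum>v\<in>{1..n} - set (perm_prefix p i). V (perm_prefix p i @ [v]))"
      using perm_prefix_props(3)[of p n i] permutes_inj_on[of p "{1..n}"] assms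
      by (simp add: sum.reindex)
  qed
  finally show ?thesis
    using assms by (simp add: sum_divide_distrib[symmetric] field_simps)
qed

section \<open>Potentials with bounded drift along a random permutation\<close>

text \<open>\<open>step\<close> says that, given the values seen so far, the conditional expectation
  of \<open>W\<close> grows by at most \<open>c\<close> per exposed value. Averaging with
  \<open>sum_permutations_next\<close> and iterating accumulates \<open>I * c\<close>.\<close>

lemma sum_permutations_drift:
  fixes W :: "nat list \<Rightarrow> real"
  assumes step: "\<And>xs. distinct xs \<Longrightarrow> set xs \<subseteq> {1..n} \<Longrightarrow> length xs < I \<Longrightarrow>
      (\<Sum>v\<in>{1..n} - set xs. W (xs @ [v])) \<le> real (n - length xs) * (W xs + c)"
    and "I \<le> n"
  shows "(\<Sum>p | p permutes {1..n}. W (perm_prefix p I)) \<le> fact n * (W [] + real I * c)"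
  using assms
proof (induction I)
  case 0
  then show ?case by (simp add: card_permutations)
next
  case (Suc I)
  let ?P = "{p. p permutes {1..n}}"
  have "(\<Sum>p\<in>?P. W (perm_prefix p (Suc I))) =
      (\<Sum>p\<in>?P. (\<Sum>v\<in>{1..n} - set (perm_prefix p I). W (perm_prefix p I @ [v])) / real (n - I))"
    using Suc.prems by (intro sum_permutations_next) auto
  also have "\<dots> \<le> (\<Sum>p\<in>?P. W (perm_prefix p I) + c)"
  proof (intro sum_mono)
    fix p assume "p \<in> ?P"
    then have "(\<Sum>v\<in>{1..n} - set (perm_prefix p I). W (perm_prefix p I @ [v])) \<le>
        real (n - length (perm_prefix p I)) * (W (perm_prefix p I) + c)"
      using perm_prefix_props[of p n I] Suc.prems(2) by (intro Suc.prems(1)) auto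
    then show "(\<Sum>v\<in>{1..n} - set (perm_prefix p I). W (perm_prefix p I @ [v])) / real (n - I) \<le>
        W (perm_prefix p I) + c"
      using Suc.prems(2) by (simp add: field_simps)
  qed
  also have "\<dots> = (\<Sum>p\<in>?P. W (perm_prefix p I)) + fact n * c"
    by (simp add: sum.distrib card_permutations)
  also have "\<dots> \<le> fact n * (W [] + real I * c) + fact n * c"
    using Suc.IH Suc.prems by simp
  finally show ?case by (simp add: algebra_simps)
qed

text \<open>Markov's inequality for the potential \<open>W\<close>: its mean after \<open>I\<close>
  values is at most \<open>I * c\<close>, and every bad permutation contributes at least
  \<open>\<delta>\<close>.\<close>

lemma card_permutations_drift:
  fixes W :: "nat list \<Rightarrow> real"
  assumes step: "\<And>xs. distinct xs \<Longrightarrow> set xs \<subseteq> {1..n} \<Longrightarrow> length xs < I \<Longrightarrow>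
      (\<Sum>v\<in>{1..n} - set xs. W (xs @ [v])) \<le> real (n - length xs) * (W xs + c)"
    and "I \<le> n" "W [] \<le> 0" "\<delta> > 0" "\<And>xs. W xs \<ge> 0"
    and big: "\<And>p. p permutes {1..n} \<Longrightarrow> R p \<Longrightarrow> W (perm_prefix p I) \<ge> \<delta>"
  shows "real (card {p. p permutes {1..n} \<and> R p}) \<le> real I * c / \<delta> * fact n"
proof -
  let ?P = "{p. p permutes {1..n}}"
  have fin: "finite ?P" using finite_permutations[of "{1..n}"] by blast
  have "real (card {p. p permutes {1..n} \<and> R p}) * \<delta> = (\<Sum>p | p permutes {1..n} \<and> R p. \<delta>)"
    by simp
  also have "\<dots> \<le> (\<Sum>p | p permutes {1..n} \<and> R p. W (perm_prefix p I))"
    by (intro sum_mono big) auto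
  also have "\<dots> \<le> (\<Sum>p\<in>?P. W (perm_prefix p I))"
    using fin assms(5) by (intro sum_mono2) auto
  also have "\<dots> \<le> fact n * (W [] + real I * c)"
    using step \<open>I \<le> n\<close> by (rule sum_permutations_drift)
  also have "\<dots> \<le> fact n * (real I * c)"
    using \<open>W [] \<le> 0\<close> by (intro mult_left_mono) auto
  finally show ?thesis
    using \<open>\<delta> > 0\<close> by (simp add: field_simps)
qed

text \<open>In the expansion of (max 0 x + d)^2 the linear term has nonpositive sum, because the
  total drift is nonpositive and the coefficient 2 max 0 x is not negative; only the squared step
  size remains. \<open>W\<close> is merely bounded by the truncated square because the potential for
  the upper bound is reset to 0 once every vertex is covered.\<close>

lemma sum_pos_part_square_le:
  fixes d :: "'a \<Rightarrow> real"
  assumes "finite A" and W: "\<And>v. v \<in> A \<Longrightarrow> W v \<le> (max 0 (x + d v))\<^sup>2"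
    and b: "\<And>v. v \<in> A \<Longrightarrow> \<bar>d v\<bar> \<le> b" and drift: "(\<Sum>v\<in>A. d v) \<le> 0"
  shows "(\<Sum>v\<in>A. W v) \<le> real (card A) * ((max 0 x)\<^sup>2 + b\<^sup>2)"
proof -
  have "W v \<le> (max 0 x)\<^sup>2 + 2 * max 0 x * d v + b\<^sup>2" if "v \<in> A" for v
  proof -
    have "(max 0 (x + d v))\<^sup>2 \<le> (max 0 x + d v)\<^sup>2"
    proof (cases "x + d v \<le> 0")
      case False
      then show ?thesis by (intro power_mono) auto
    qed auto
    also have "\<dots> = (max 0 x)\<^sup>2 + 2 * max 0 x * d v + (d v)\<^sup>2"
      by (simp add: power2_sum)
    also have "(d v)\<^sup>2 \<le> b\<^sup>2"
      using b[OF that] by (simp add: abs_le_square_iff[symmetric])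
    finally show ?thesis using W[OF that] by linarith
  qed
  then have "(\<Sum>v\<in>A. W v) \<le> (\<Sum>v\<in>A. (max 0 x)\<^sup>2 + 2 * max 0 x * d v + b\<^sup>2)"
    by (rule sum_mono)
  also have "\<dots> = real (card A) * ((max 0 x)\<^sup>2 + b\<^sup>2) + 2 * max 0 x * (\<Sum>v\<in>A. d v)"
    by (simp add: sum.distrib sum_distrib_left distrib_left)
  also have "2 * max 0 x * (\<Sum>v\<in>A. d v) \<le> 0"
    using drift by (intro mult_nonneg_nonpos) auto
  finally show ?thesis by simp
qed

section \<open>Cuts of circulant graphs\<close>

text \<open>A subset of the integers modulo n is encoded as an n-periodic predicate, so that shifts
  are plain integer additions and reduction modulo n matters only for counting.\<close>

locale cyclic_set =
  fixes n :: int and P :: "int \<Rightarrow> bool"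
  assumes n_pos: "n > 0" and P_mod: "P (z mod n) = P z"
begin

definition crossings :: "int \<Rightarrow> nat" where
  "crossings d = card {v \<in> {0..<n}. P v \<noteq> P (v + d)}"

definition exits :: "int \<Rightarrow> nat" where
  "exits d = card {v \<in> {0..<n}. P v \<and> \<not> P (v + d)}"

lemma P_mod_add: "P (z mod n + d) = P (z + d)"
  by (metis P_mod mod_add_left_eq)

lemma P_cong: "z mod n = z' mod n \<Longrightarrow> P z = P z'"
  by (metis P_mod)

lemma finite_cycle [simp]: "finite {v. 0 \<le> v \<and> v < n \<and> Q v}"
  by (rule finite_subset[of _ "{0..<n}"]) auto

lemma card_shift:
  assumes "\<And>z. Q (z mod n) = Q z"
  shows "card {v \<in> {0..<n}. Q (v + c)} = card {v \<in> {0..<n}. Q v}"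
proof (rule bij_betw_same_card[of "\<lambda>v. (v + c) mod n"])
  show "bij_betw (\<lambda>v. (v + c) mod n) {v \<in> {0..<n}. Q (v + c)} {v \<in> {0..<n}. Q v}"
  proof (rule bij_betw_byWitness[where f' = "\<lambda>v. (v - c) mod n"])
    have "Q ((v - c) mod n + c) = Q v" for v
      by (metis assms diff_add_cancel mod_add_left_eq)
    then show "(\<lambda>v. (v - c) mod n) ` {v \<in> {0..<n}. Q v} \<subseteq> {v \<in> {0..<n}. Q (v + c)}"
      using n_pos by auto
  qed (use n_pos assms in \<open>auto simp: mod_simps\<close>)
qed

text \<open>A set and its translate are equally large, so as many steps of length \<open>d\<close>
  enter the set as leave it.\<close>

lemma crossings_eq: "crossings d = 2 * exits d"
proof -
  let ?both = "card {v \<in> {0..<n}. P v \<and> P (v + d)}"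
  let ?enters = "card {v \<in> {0..<n}. \<not> P v \<and> P (v + d)}"
  have "card {v \<in> {0..<n}. P v} = exits d + ?both"
    unfolding exits_def by (subst card_Un_disjoint[symmetric]) (auto intro!: arg_cong[where f = card])
  moreover have "card {v \<in> {0..<n}. P (v + d)} = ?enters + ?both"
    by (subst card_Un_disjoint[symmetric]) (auto intro!: arg_cong[where f = card])
  moreover have "card {v \<in> {0..<n}. P (v + d)} = card {v \<in> {0..<n}. P v}"
    by (rule card_shift) (rule P_mod)
  moreover have "crossings d = exits d + ?enters"
    unfolding crossings_def exits_def
    by (subst card_Un_disjoint[symmetric]) (auto intro!: arg_cong[where f = card])
  ultimately show ?thesis by simp
qed

text \<open>If \<open>P\<close> changes between v and v + 1, it changes between v and v + d + 1 or
  between v + 1 and v + d + 1. This bounds \<open>crossings 1\<close> by a sum, and halving gives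
  the claim.\<close>

lemma exits_1_le: "exits 1 \<le> exits (d + 1) + exits d"
proof -
  have "crossings 1 \<le> card ({v \<in> {0..<n}. P v \<noteq> P (v + (d + 1))} \<union>
      {v \<in> {0..<n}. P (v + 1) \<noteq> P ((v + 1) + d)})"
    unfolding crossings_def by (intro card_mono) (auto simp: algebra_simps)
  also have "\<dots> \<le> crossings (d + 1) + card {v \<in> {0..<n}. P (v + 1) \<noteq> P ((v + 1) + d)}"
    unfolding crossings_def by (rule card_Un_le)
  also have "card {v \<in> {0..<n}. P (v + 1) \<noteq> P ((v + 1) + d)} = crossings d"
    unfolding crossings_def
    by (rule card_shift[of "\<lambda>v. P v \<noteq> P (v + d)"]) (simp add: P_mod P_mod_add)
  finally show ?thesis by (simp add: crossings_eq)
qed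

lemma mod_in: "z mod n \<in> {0..<n}"
  using n_pos by simp

lemma exits_ge:
  assumes "\<And>x. x \<in> X \<Longrightarrow> P x \<and> \<not> P (x + d)" and "inj_on (\<lambda>x. x mod n) X"
  shows "card X \<le> exits d"
proof -
  have "(\<lambda>x. x mod n) ` X \<subseteq> {v \<in> {0..<n}. P v \<and> \<not> P (v + d)}"
    using assms(1) n_pos by (auto simp: P_mod P_mod_add)
  then show ?thesis
    unfolding exits_def by (rule card_inj_on_le[OF assms(2)]) simp
qed

lemma mod_neq: "0 < d \<Longrightarrow> d < n \<Longrightarrow> (x + d) mod n \<noteq> x mod n"
  by (metis add_diff_cancel_left' mod_eq_dvd_iff zdvd_not_zless)

text \<open>Without an exit of length 1, membership propagates from \<open>y\<close> through all
  residues and reaches \<open>z\<close>.\<close>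

lemma exists_exit:
  assumes "P y" "\<not> P z"
  shows "\<exists>x. P x \<and> \<not> P (x + 1)"
proof (rule ccontr)
  assume none: "\<not> ?thesis"
  have "P (y + int j)" for j
  proof (induction j)
    case (Suc j)
    then show ?case using none by (auto simp: algebra_simps)
  qed (use assms in auto)
  from this[of "nat ((z - y) mod n)"] have "P (y + (z - y) mod n)"
    using n_pos by simp
  moreover have "(y + (z - y) mod n) mod n = z mod n"
    by (simp add: mod_simps)
  ultimately show False
    using assms(2) P_cong by blast
qed

text \<open>If no step of length \<open>d\<close> leaves the set, then translating an exit of length 1 by \<open>d\<close> and \<open>2 d\<close>
  gives two further exits.\<close>

lemma exits_1_ge_3:
  assumes "0 < d" "2 * d < n" "exits d = 0" "P x" "\<not> P (x + 1)"
  shows "exits 1 \<ge> 3"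
proof -
  \<comment> \<open>No step of length \<open>d\<close> leaves the set, hence by
    \<open>crossings_eq\<close> none enters it, and the set is invariant under the shift.\<close>
  have inv: "P (v + d) = P v" for v
  proof -
    have "{v \<in> {0..<n}. P v \<noteq> P (v + d)} = {}"
      using crossings_eq[of d] assms(3) unfolding crossings_def
      by (simp only: mult_0_right card_eq_0_iff) simp
    then have "P (v mod n) = P (v mod n + d)"
      using mod_in[of v] by blast
    then show ?thesis by (simp add: P_mod P_mod_add)
  qed
  have "card {x, x + d, x + d + d} \<le> exits 1"
  proof (rule exits_ge)
    have "P (x + d + 1) = P (x + 1)" "P (x + d + d + 1) = P (x + 1)"
      using inv[of "x + 1"] inv[of "x + 1 + d"] by (simp_all only: ac_simps)
    then show "P y \<and> \<not> P (y + 1)" if "y \<in> {x, x + d, x + d + d}" for y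
      using assms(4,5) that inv[of x] inv[of "x + d"] by blast
  next
    \<comment> \<open>The pairwise differences are d and 2 d, both strictly between 0 and n.\<close>
    show "inj_on (\<lambda>x. x mod n) {x, x + d, x + d + d}"
      using mod_neq[of d x] mod_neq[of d "x + d"] mod_neq[of "d + d" x] assms(1,2)
      unfolding inj_on_def add.assoc by simp
  qed
  moreover have "card {x, x + d, x + d + d} = 3"
    using assms(1) by auto
  ultimately show ?thesis by simp
qed

text \<open>With a single exit the set is a cyclic interval ending at x. As it and its complement
  have at least two elements each, x - 1 belongs to it and x + 2 does not, so both x and x - 1 leave
  it by a step of length 2.\<close>

lemma exits_2_ge_2:
  assumes "exits 1 = 1" "card {v \<in> {0..<n}. P v} \<ge> 2" "card {v \<in> {0..<n}. \<not> P v} \<ge> 2"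
    and x: "P x" "\<not> P (x + 1)"
  shows "exits 2 \<ge> 2"
proof -
  obtain y where y: "{v \<in> {0..<n}. P v \<and> \<not> P (v + 1)} = {y}"
    using assms(1) unfolding exits_def by (auto simp: card_1_singleton_iff)
  have uniq: "v mod n = x mod n" if "P v" "\<not> P (v + 1)" for v
  proof -
    have "v mod n \<in> {y}" "x mod n \<in> {y}"
      using that x mod_in unfolding y[symmetric] by (auto simp: P_mod P_mod_add)
    then show ?thesis by simp
  qed
  have "card {v \<in> {0..<n}. \<not> P v} \<le> card {0..<n}"
    by (intro card_mono) auto
  then have n2: "n \<ge> 2" using assms(3) by simp
  have "\<not> P (x + 2)"
  proof
    assume P2: "P (x + 2)"
    \<comment> \<open>If x + 2 were in the set, the run starting there could only stop at the unique
      exit x, and x + 1 would be the only element of the complement.\<close>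
    have run: "P (x + 2 + int j)" if "int j + 2 \<le> n" for j
      using that
    proof (induction j)
      case (Suc j)
      then have "P (x + 2 + int j)" by simp
      moreover have "(x + (2 + int j)) mod n \<noteq> x mod n"
        using Suc.prems by (intro mod_neq) auto
      ultimately show ?case
        using uniq[of "x + 2 + int j"] by (auto simp: algebra_simps)
    qed (use P2 in auto)
    have "v = (x + 1) mod n" if "v \<in> {0..<n}" "\<not> P v" for v
    proof (rule ccontr)
      assume ne: "v \<noteq> (x + 1) mod n"
      define j where "j = (v - (x + 1)) mod n"
      have vj: "(x + 1 + j) mod n = v"
        using that by (simp add: j_def mod_simps)
      have "j \<noteq> 0" using ne vj by auto
      moreover have "0 \<le> j" "j < n"
        using n_pos by (simp_all add: j_def)
      ultimately have "1 \<le> j" by linarith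
      then have "P (x + 2 + int (nat (j - 1)))"
        using \<open>j < n\<close> by (intro run) linarith
      then have "P (x + 1 + j)" using \<open>1 \<le> j\<close> by (simp add: algebra_simps)
      then show False using that(2) vj P_mod by metis
    qed
    then have "{v \<in> {0..<n}. \<not> P v} \<subseteq> {(x + 1) mod n}" by auto
    then have "card {v \<in> {0..<n}. \<not> P v} \<le> card {(x + 1) mod n}" by (intro card_mono) auto
    then show False using assms(3) by simp
  qed
  moreover have "P (x - 1)"
  proof (rule ccontr)
    assume nP: "\<not> P (x - 1)"
    \<comment> \<open>Walking backwards from x - 1, any element met before returning to x would
      yield a second exit, so x would be the only element of the set.\<close>
    have run: "\<not> P (x - 1 - int j)" if "int j + 1 < n" for j
      using that
    proof (induction j)
      case (Suc j)
      then have "\<not> P (x - 2 - int j + 1)" by (simp add: algebra_simps)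
      moreover have "(x - 2 - int j + (2 + int j)) mod n \<noteq> (x - 2 - int j) mod n"
        using Suc.prems by (intro mod_neq) auto
      ultimately show ?case
        using uniq[of "x - 2 - int j"] by (auto simp: algebra_simps)
    qed (use nP in auto)
    have "v = x mod n" if "v \<in> {0..<n}" "P v" for v
    proof (rule ccontr)
      assume ne: "v \<noteq> x mod n"
      define j where "j = (x - v) mod n"
      have vj: "(x - j) mod n = v"
        using that by (simp add: j_def mod_simps)
      have "j \<noteq> 0" using ne vj by auto
      moreover have "0 \<le> j" "j < n"
        using n_pos by (simp_all add: j_def)
      ultimately have "1 \<le> j" by linarith
      then have "\<not> P (x - 1 - int (nat (j - 1)))"
        using \<open>j < n\<close> by (intro run) linarith
      then have "\<not> P (x - j)" using \<open>1 \<le> j\<close> by (simp add: algebra_simps)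
      then show False using that(2) vj P_mod by metis
    qed
    then have "{v \<in> {0..<n}. P v} \<subseteq> {x mod n}" by auto
    then have "card {v \<in> {0..<n}. P v} \<le> card {x mod n}" by (intro card_mono) auto
    then show False using assms(2) by simp
  qed
  ultimately have "card {x, x - 1} \<le> exits 2"
    using x n2 mod_neq[of 1 "x - 1"] by (intro exits_ge) (auto simp: inj_on_def algebra_simps)
  then show ?thesis by simp
qed

text \<open>The steps from 2 to 2 j + 1 split into pairs 2 i, 2 i + 1, and \<open>exits_1_le\<close>
  gives at least \<open>exits 1\<close> for each of the j pairs; step 1 contributes one
  more.\<close>

lemma sum_exits_odd_ge: "(\<Sum>d=1..2 * j + 1. exits (int d)) \<ge> (j + 1) * exits 1"
proof (induction j)
  case (Suc j)
  have "{1..2 * Suc j + 1} = insert (2 * j + 3) (insert (2 * j + 2) {1..2 * j + 1})" by auto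
  then have "(\<Sum>d=1..2 * Suc j + 1. exits (int d)) =
      exits (int (2 * j + 3)) + (exits (int (2 * j + 2)) + (\<Sum>d=1..2 * j + 1. exits (int d)))"
    by (simp only:, subst sum.insert, simp, simp, subst sum.insert) (simp_all only: finite_atLeastAtMost, simp)
  moreover have "exits 1 \<le> exits (int (2 * j + 3)) + exits (int (2 * j + 2))"
    using exits_1_le[of "int (2 * j + 2)"] by (simp add: algebra_simps)
  ultimately show ?case using Suc by (simp only: add_Suc mult_Suc)
qed auto

text \<open>The split is on the number of exits of length 1. If it is at least 2, pairing the steps
  suffices up to a leftover step for even \<open>k\<close>; if it is 1, every step has an exit by
  \<open>exits_1_ge_3\<close>, and step 2 has two.\<close>

lemma sum_exits_ge:
  assumes "2 \<le> k" "2 * int k < n"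
    and P2: "card {v \<in> {0..<n}. P v} \<ge> 2" and nP2: "card {v \<in> {0..<n}. \<not> P v} \<ge> 2"
  shows "(\<Sum>d=1..k. exits (int d)) \<ge> k + 1"
proof -
  have "{v \<in> {0..<n}. P v} \<noteq> {}" "{v \<in> {0..<n}. \<not> P v} \<noteq> {}"
    using P2 nP2 by (metis card.empty not_numeral_le_zero)+
  then obtain x where x: "P x" "\<not> P (x + 1)"
    using exists_exit by blast
  have x1: "exits 1 \<ge> 1"
    using exits_ge[of "{x}" 1] x by auto
  show ?thesis
  proof (cases "exits 1 \<ge> 2")
    case True
    show ?thesis
    proof (cases "odd k")
      case True
      then obtain j where j: "k = 2 * j + 1" by (auto elim: oddE)
      have "(j + 1) * 2 \<le> (j + 1) * exits 1"
        using \<open>exits 1 \<ge> 2\<close> by (intro mult_left_mono) auto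
      then have "k + 1 \<le> (j + 1) * exits 1" using j by simp
      also have "\<dots> \<le> (\<Sum>d=1..k. exits (int d))"
        unfolding j by (rule sum_exits_odd_ge)
      finally show ?thesis .
    next
      case False
      then obtain m where "k = 2 * m" by (auto elim: evenE)
      then have "k = 2 * (m - 1) + 2" using assms(1) by simp
      then obtain j where j: "k = 2 * j + 2" by blast
      have "{1..k} = insert k {1..2 * j + 1}" using j by auto
      then have S: "(\<Sum>d=1..k. exits (int d)) = exits (int k) + (\<Sum>d=1..2 * j + 1. exits (int d))"
        by (simp only:, subst sum.insert) (auto simp: j)
      \<comment> \<open>The paired steps 1 to k - 1 give k / 2 times \<open>exits 1\<close>. This
        suffices when \<open>exits 1\<close> is at least 3; when it is 2, one exit is missing and
        comes from step \<open>k\<close>, since \<open>exits (int k) = 0\<close> would force three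
        exits of length 1.\<close>
      have "k + 1 \<le> (j + 1) * exits 1 + exits (int k)"
      proof (cases "exits 1 \<ge> 3")
        case True
        then have "(j + 1) * 3 \<le> (j + 1) * exits 1"
          by (intro mult_left_mono) auto
        then have "3 * j + 3 \<le> (j + 1) * exits 1" by simp
        then show ?thesis unfolding j by (intro trans_le_add1) simp
      next
        case False
        then have "exits (int k) \<noteq> 0"
          using exits_1_ge_3[of "int k" x] x assms(1,2) by auto
        moreover have "exits 1 = 2" using False \<open>exits 1 \<ge> 2\<close> by simp
        ultimately show ?thesis using j by simp
      qed
      also have "(j + 1) * exits 1 + exits (int k) \<le> (\<Sum>d=1..k. exits (int d))"
        unfolding S using add_right_mono[OF sum_exits_odd_ge[of j]] by (simp only: add.commute)
      finally show ?thesis .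
    qed
  next
    case False
    then have 1: "exits 1 = 1" using x1 by simp
    have "exits (int d) \<ge> 1" if "d \<in> {1..k}" for d
    proof -
      have "exits (int d) \<noteq> 0"
        using exits_1_ge_3[of "int d" x] x that assms(2) 1 by auto
      then show ?thesis by simp
    qed
    then have "(\<Sum>d\<in>{1..k} - {2}. 1) \<le> (\<Sum>d\<in>{1..k} - {2}. exits (int d))"
      by (intro sum_mono) auto
    then have "k - 1 \<le> (\<Sum>d\<in>{1..k} - {2}. exits (int d))"
      using assms(1) by simp
    moreover have "2 \<le> exits (int 2)"
      using exits_2_ge_2[OF 1 P2 nP2 x] by simp
    ultimately have "2 + (k - 1) \<le> exits (int 2) + (\<Sum>d\<in>{1..k} - {2}. exits (int d))"
      by (rule add_mono[rotated])
    also have "\<dots> = (\<Sum>d=1..k. exits (int d))"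
      using assms(1) by (intro sum.remove[symmetric]) auto
    finally show ?thesis using assms(1) by linarith
  qed
qed

end

section \<open>Circulant graphs on the vertices 1 to n and their edge-connectivity\<close>

text \<open>Residues start at 0 and vertices at 1, so vertex v has residue v - 1.\<close>

definition vertex :: "nat \<Rightarrow> int \<Rightarrow> nat" where
  "vertex n z = nat (z mod int n) + 1"

definition circulant :: "nat \<Rightarrow> nat \<Rightarrow> nat set set" where
  "circulant n k = {{vertex n z, vertex n (z + int d)} | z d. d \<in> {1..k}}"

definition edge_cut :: "nat set set \<Rightarrow> nat set \<Rightarrow> nat set set" where
  "edge_cut E S = {e \<in> E. e \<inter> S \<noteq> {} \<and> \<not> e \<subseteq> S}"

lemma vertex_in: "n > 0 \<Longrightarrow> vertex n z \<in> {1..n}"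
  by (auto simp: vertex_def Suc_le_eq nat_less_iff)

lemma vertex_eq_iff: "n > 0 \<Longrightarrow> vertex n z = vertex n z' \<longleftrightarrow> z mod int n = z' mod int n"
  by (simp add: vertex_def eq_nat_nat_iff)

lemma vertex_minus_1: "v \<in> {1..n} \<Longrightarrow> vertex n (int v - 1) = v"
  by (auto simp: vertex_def)

lemma circulant_subset: "n > 0 \<Longrightarrow> circulant n k \<subseteq> Pow {1..n}"
  using vertex_in unfolding circulant_def by blast

lemma finite_circulant: "n > 0 \<Longrightarrow> finite (circulant n k)"
  using circulant_subset by (rule finite_subset) auto

lemma labeled_graph_circulant:
  assumes "k < n"
  shows "labeled_graph n (circulant n k)"
  unfolding labeled_graph_def
proof
  fix e assume "e \<in> circulant n k"
  then obtain z d where e: "e = {vertex n z, vertex n (z + int d)}" "d \<in> {1..k}"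
    by (auto simp: circulant_def)
  interpret cyclic_set "int n" "\<lambda>_. True"
    using assms by unfold_locales auto
  have "vertex n (z + int d) \<noteq> vertex n z"
    using assms e(2) mod_neq[of "int d" z] by (simp add: vertex_eq_iff)
  then show "e \<subseteq> {1..n} \<and> card e = 2"
    using e(1) assms vertex_in[of n] by auto
qed

text \<open>Representations with the same orientation agree modulo n. With opposite orientations n
  would divide d + d', which 0 < d + d' \<le> 2 k < n excludes.\<close>

lemma circulant_edge_inj:
  assumes "2 * k < n" "d \<in> {1..k}" "d' \<in> {1..k}" "z \<in> {0..<int n}" "z' \<in> {0..<int n}"
    and eq: "{vertex n z, vertex n (z + int d)} = {vertex n z', vertex n (z' + int d')}"
  shows "z = z' \<and> d = d'"
proof -
  have "n > 0" using assms by auto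
  interpret cyclic_set "int n" "\<lambda>_. True"
    using \<open>n > 0\<close> by unfold_locales auto
  have "(z mod int n = z' mod int n \<and> (z + int d) mod int n = (z' + int d') mod int n) \<or>
      (z mod int n = (z' + int d') mod int n \<and> (z + int d) mod int n = z' mod int n)"
    using eq \<open>n > 0\<close> by (simp add: doubleton_eq_iff vertex_eq_iff)
  then show ?thesis
  proof
    assume h: "z mod int n = z' mod int n \<and> (z + int d) mod int n = (z' + int d') mod int n"
    then have "z = z'" using assms(4,5) by simp
    moreover have "int d mod int n = int d' mod int n"
      using h unfolding \<open>z = z'\<close> by (simp only: mod_eq_dvd_iff add_diff_cancel_left)
    then have "d = d'" using assms(1-3) by simp
    ultimately show ?thesis ..
  next
    assume h: "z mod int n = (z' + int d') mod int n \<and> (z + int d) mod int n = z' mod int n"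
    then have "(z' + int d' + int d) mod int n = z' mod int n"
      by (metis mod_add_left_eq)
    then have "(z' + (int d' + int d)) mod int n = z' mod int n"
      by (simp only: add.assoc)
    moreover have "(z' + (int d' + int d)) mod int n \<noteq> z' mod int n"
      using assms(1-3) by (intro mod_neq) auto
    ultimately show ?thesis by blast
  qed
qed

lemma cyclic_set_vertex: "n > 0 \<Longrightarrow> cyclic_set (int n) (\<lambda>z. vertex n z \<in> S)"
  by unfold_locales (auto simp: vertex_def)

text \<open>Each crossing of a step up to \<open>k\<close> is a cut edge, and distinct pairs of a
  step and a base point give distinct edges by \<open>circulant_edge_inj\<close>; the factor 2 is
  \<open>crossings_eq\<close>.\<close>

lemma card_cut_circulant_ge:
  assumes "2 * k < n"
  shows "2 * (\<Sum>d=1..k. cyclic_set.exits (int n) (\<lambda>z. vertex n z \<in> S) (int d)) \<le>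
    card (edge_cut (circulant n k) S)"
proof -
  have "n > 0" using assms by auto
  interpret cyclic_set "int n" "\<lambda>z. vertex n z \<in> S"
    using \<open>n > 0\<close> by (rule cyclic_set_vertex)
  define C where "C d = {z \<in> {0..<int n}. (vertex n z \<in> S) \<noteq> (vertex n (z + int d) \<in> S)}" for d :: nat
  define F where "F = (\<lambda>(d :: nat, z). {vertex n z, vertex n (z + int d)})"
  have "2 * (\<Sum>d=1..k. exits (int d)) = (\<Sum>d=1..k. card (C d))"
    by (simp only: sum_distrib_left crossings_eq[symmetric] crossings_def C_def)
  also have "\<dots> = card (Sigma {1..k} C)"
    by (subst card_SigmaI) (auto simp: C_def)
  also have "\<dots> = card (F ` Sigma {1..k} C)"
  proof (rule card_image[symmetric], rule inj_onI)
    fix x y assume xy: "x \<in> Sigma {1..k} C" "y \<in> Sigma {1..k} C" "F x = F y"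
    obtain d z d' z' where [simp]: "x = (d, z)" "y = (d', z')" by fastforce
    have "z = z' \<and> d = d'"
      using xy assms by (intro circulant_edge_inj[of k]) (auto simp: C_def F_def)
    then show "x = y" by simp
  qed
  also have "\<dots> \<le> card (edge_cut (circulant n k) S)"
  proof (rule card_mono)
    show "finite (edge_cut (circulant n k) S)"
      using finite_circulant[OF \<open>n > 0\<close>] by (simp add: edge_cut_def)
    show "F ` Sigma {1..k} C \<subseteq> edge_cut (circulant n k) S"
    proof
      fix e assume "e \<in> F ` Sigma {1..k} C"
      then obtain d z where dz: "d \<in> {1..k}" "z \<in> C d" "e = {vertex n z, vertex n (z + int d)}"
        by (auto simp: F_def)
      then have "e \<in> circulant n k" unfolding circulant_def by blast
      with dz show "e \<in> edge_cut (circulant n k) S" by (auto simp: edge_cut_def C_def)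
    qed
  qed
  finally show ?thesis .
qed

lemma bij_betw_vertex: "n > 0 \<Longrightarrow> bij_betw (vertex n) {0..<int n} {1..n}"
  by (rule bij_betw_byWitness[where f' = "\<lambda>v. int v - 1"]) (auto simp: vertex_def nat_less_iff Suc_le_eq)

lemma card_vertex_Collect:
  assumes "n > 0"
  shows "card {z \<in> {0..<int n}. vertex n z \<in> S} = card ({1..n} \<inter> S)"
proof (rule bij_betw_same_card[of "vertex n"])
  have "vertex n ` {z \<in> {0..<int n}. vertex n z \<in> S} = vertex n ` {0..<int n} \<inter> S" by auto
  then have "vertex n ` {z \<in> {0..<int n}. vertex n z \<in> S} = {1..n} \<inter> S"
    by (simp only: bij_betw_imp_surj_on[OF bij_betw_vertex[OF assms]])
  moreover have "inj_on (vertex n) {z \<in> {0..<int n}. vertex n z \<in> S}"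
    by (rule inj_on_subset[OF bij_betw_imp_inj_on[OF bij_betw_vertex[OF assms]]]) auto
  ultimately show "bij_betw (vertex n) {z \<in> {0..<int n}. vertex n z \<in> S} ({1..n} \<inter> S)"
    by (simp add: bij_betw_def)
qed

lemma card_cut_circulant_nontrivial:
  assumes "2 \<le> k" "2 * k < n" "S \<subseteq> {1..n}" "2 \<le> card S" "card S + 2 \<le> n"
  shows "2 * k + 1 \<le> card (edge_cut (circulant n k) S)"
proof -
  have "n > 0" using assms by auto
  interpret cyclic_set "int n" "\<lambda>z. vertex n z \<in> S"
    using \<open>n > 0\<close> by (rule cyclic_set_vertex)
  have "{1..n} \<inter> S = S" "{1..n} \<inter> - S = {1..n} - S" using assms(3) by auto
  moreover have "card ({1..n} - S) = n - card S"
    using assms(3) by (subst card_Diff_subset) (auto intro: finite_subset)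
  ultimately have "2 \<le> card {z \<in> {0..<int n}. vertex n z \<in> S}"
    "2 \<le> card {z \<in> {0..<int n}. \<not> vertex n z \<in> S}"
    using card_vertex_Collect[OF \<open>n > 0\<close>, of S] card_vertex_Collect[OF \<open>n > 0\<close>, of "- S"] assms(4,5)
    by simp_all
  then have "k + 1 \<le> (\<Sum>d=1..k. exits (int d))"
    using assms(1,2) by (intro sum_exits_ge) auto
  with card_cut_circulant_ge[OF assms(2), of S] show ?thesis by linarith
qed

lemma card_cut_circulant_singleton:
  assumes "2 * k < n" "w \<in> {1..n}"
  shows "2 * k \<le> card (edge_cut (circulant n k) {w})"
proof -
  have "n > 0" using assms by auto
  interpret cyclic_set "int n" "\<lambda>z. vertex n z \<in> {w}"
    using \<open>n > 0\<close> by (rule cyclic_set_vertex)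
  have "(\<Sum>d=1..k. 1) \<le> (\<Sum>d=1..k. exits (int d))"
  proof (rule sum_mono)
    fix d assume d: "d \<in> {1..k}"
    have "vertex n (int w - 1) = w" by (rule vertex_minus_1[OF assms(2)])
    moreover have "vertex n (int w - 1 + int d) \<noteq> vertex n (int w - 1)"
      using d assms \<open>n > 0\<close> mod_neq[of "int d" "int w - 1"] by (simp add: vertex_eq_iff)
    ultimately have "card {int w - 1} \<le> exits (int d)"
      by (intro exits_ge) auto
    then show "1 \<le> exits (int d)" by simp
  qed
  with card_cut_circulant_ge[OF assms(1), of "{w}"] show ?thesis by simp
qed

lemma cut_complement:
  assumes "labeled_graph n E" "S \<subseteq> {1..n}"
  shows "edge_cut E ({1..n} - S) = edge_cut E S"
proof -
  have "e \<inter> ({1..n} - S) \<noteq> {} \<and> \<not> e \<subseteq> {1..n} - S \<longleftrightarrow> e \<inter> S \<noteq> {} \<and> \<not> e \<subseteq> S" if "e \<in> E" for e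
    using assms that unfolding labeled_graph_def by blast
  then show ?thesis unfolding edge_cut_def by blast
qed

text \<open>If deleting \<open>D\<close> separates u from v, the set of vertices still reachable
  from u has its whole cut inside \<open>D\<close>, so \<open>D\<close> has at least
  \<open>l\<close> edges.\<close>

lemma edge_connected_if_cuts:
  assumes "finite E" "labeled_graph n E" "n \<ge> 2"
    and cuts: "\<And>S. S \<subseteq> {1..n} \<Longrightarrow> S \<noteq> {} \<Longrightarrow> S \<noteq> {1..n} \<Longrightarrow> l \<le> card (edge_cut E S)"
  shows "edge_connected n l E"
  unfolding edge_connected_def
proof (intro conjI allI impI)
  show "n \<ge> 2" by fact
  fix D assume D: "D \<subseteq> E \<and> card D < l"
  let ?R = "{(x, y). {x, y} \<in> E - D}"
  show "connected_graph n (E - D)"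
    unfolding connected_graph_def
  proof (intro ballI, rule ccontr)
    fix u v assume uv: "u \<in> {1..n}" "v \<in> {1..n}" "(u, v) \<notin> ?R\<^sup>*"
    define S where "S = {y \<in> {1..n}. (u, y) \<in> ?R\<^sup>*}"
    have "edge_cut E S \<subseteq> D"
    proof
      fix e assume e: "e \<in> edge_cut E S"
      then have eE: "e \<in> E" and "e \<subseteq> {1..n}" "card e = 2"
        using assms(2) by (auto simp: edge_cut_def labeled_graph_def)
      then obtain a b where ab: "e = {a, b}" "a \<in> S" "b \<notin> S"
        using e unfolding edge_cut_def by (auto simp: card_2_iff)
      show "e \<in> D"
      proof (rule ccontr)
        assume "e \<notin> D"
        then have "(a, b) \<in> ?R" using eE ab(1) by auto
        then have "(u, b) \<in> ?R\<^sup>*"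
          using ab(2) unfolding S_def by (auto intro: rtrancl_into_rtrancl)
        then show False using ab \<open>e \<subseteq> {1..n}\<close> by (auto simp: S_def)
      qed
    qed
    moreover have "finite D" using D assms(1) finite_subset by blast
    ultimately have "card (edge_cut E S) \<le> card D" by (intro card_mono)
    moreover have "u \<in> S" "v \<notin> S" "S \<subseteq> {1..n}"
      using uv unfolding S_def by blast+
    then have "l \<le> card (edge_cut E S)"
      using uv(2) by (intro cuts) blast+
    ultimately show False using D by simp
  qed
qed

text \<open>Cuts with at least two vertices on both sides have enough circulant edges already. A cut
  around one vertex has 2 k of them and gains the additional edge there; a cut around all but one
  vertex is such a cut seen from the other side.\<close>

lemma edge_connected_circulant_extension:
  assumes "2 \<le> k" "2 * k < n" "finite E" "labeled_graph n E" "circulant n k \<subseteq> E"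
    and extra: "\<And>w. w \<in> {1..n} \<Longrightarrow> \<exists>e\<in>E - circulant n k. w \<in> e"
  shows "edge_connected n (2 * k + 1) E"
proof (rule edge_connected_if_cuts)
  show "finite E" "labeled_graph n E" by fact+
  show "n \<ge> 2" using assms by simp
  have single: "2 * k + 1 \<le> card (edge_cut E {w})" if w: "w \<in> {1..n}" for w
  proof -
    obtain e where e: "e \<in> E - circulant n k" "w \<in> e" using extra[OF w] by blast
    then have "card e = 2" using assms(4) by (auto simp: labeled_graph_def)
    then have "\<not> e \<subseteq> {w}" by (auto simp: subset_singleton_iff)
    then have "insert e (edge_cut (circulant n k) {w}) \<subseteq> edge_cut E {w}"
      using e assms(5) by (auto simp: edge_cut_def)
    then have "card (insert e (edge_cut (circulant n k) {w})) \<le> card (edge_cut E {w})"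
      using \<open>finite E\<close> by (intro card_mono) (auto simp: edge_cut_def)
    moreover have "e \<notin> edge_cut (circulant n k) {w}" using e by (simp add: edge_cut_def)
    moreover have "finite (edge_cut (circulant n k) {w})"
      using assms(3,5) by (auto simp: edge_cut_def intro: finite_subset)
    ultimately show ?thesis
      using card_cut_circulant_singleton[OF assms(2) w] by simp
  qed
  fix S assume S: "S \<subseteq> {1..n}" "S \<noteq> {}" "S \<noteq> {1..n}"
  have finS: "finite S" using S(1) finite_subset by blast
  have card_compl: "card ({1..n} - S) = n - card S"
    using S(1) finS by (subst card_Diff_subset) auto
  have "card S < n"
    using psubset_card_mono[of "{1..n}" S] S by auto
  have "card S \<noteq> 0" using S(2) finS by simp
  consider "card S = 1" | "card ({1..n} - S) = 1" | "2 \<le> card S" "card S + 2 \<le> n"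
    using \<open>card S < n\<close> \<open>card S \<noteq> 0\<close> card_compl by linarith
  then show "2 * k + 1 \<le> card (edge_cut E S)"
  proof cases
    case 1
    then obtain w where "S = {w}" by (auto simp: card_1_singleton_iff)
    then show ?thesis using single S(1) by auto
  next
    case 2
    then obtain w where w: "{1..n} - S = {w}" by (auto simp: card_1_singleton_iff)
    then have "w \<in> {1..n}" by blast
    then show ?thesis
      using single[of w] cut_complement[OF assms(4) S(1)] w by simp
  next
    case 3
    have "edge_cut (circulant n k) S \<subseteq> edge_cut E S"
      using assms(5) by (auto simp: edge_cut_def)
    then have "card (edge_cut (circulant n k) S) \<le> card (edge_cut E S)"
      using \<open>finite E\<close> by (intro card_mono) (auto simp: edge_cut_def)
    then show ?thesis
      using card_cut_circulant_nontrivial[OF assms(1,2) S(1) 3] by simp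
  qed
qed

text \<open>These are the choices that would give a loop or repeat a circulant edge when v is
  offered.\<close>

definition closed_nbhd :: "nat \<Rightarrow> nat \<Rightarrow> nat \<Rightarrow> nat set" where
  "closed_nbhd n k v = {u \<in> {1..n}. u = v \<or> {u, v} \<in> circulant n k}"

text \<open>Neighbours of v differ from it by an offset between -k and k, and offset 0 is v
  itself.\<close>

lemma card_closed_nbhd_le:
  assumes "v \<in> {1..n}"
  shows "card (closed_nbhd n k v) \<le> 2 * k + 1"
proof -
  have "n > 0" using assms by auto
  have "closed_nbhd n k v \<subseteq> (\<lambda>d. vertex n (int v - 1 + d)) ` {- int k..int k}"
  proof
    fix u assume u: "u \<in> closed_nbhd n k v"
    have v: "vertex n (int v - 1) = v" by (rule vertex_minus_1[OF assms])
    show "u \<in> (\<lambda>d. vertex n (int v - 1 + d)) ` {- int k..int k}"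
    proof (cases "u = v")
      case True
      then show ?thesis using v by (intro image_eqI[of _ _ 0]) auto
    next
      case False
      then obtain z d where zd: "{u, v} = {vertex n z, vertex n (z + int d)}" "d \<in> {1..k}"
        using u by (auto simp: closed_nbhd_def circulant_def)
      then consider "u = vertex n z" "v = vertex n (z + int d)" | "v = vertex n z" "u = vertex n (z + int d)"
        by (auto simp: doubleton_eq_iff)
      then show ?thesis
      proof cases
        case 1
        then have "(int v - 1) mod int n = (z + int d) mod int n"
          using v vertex_eq_iff[OF \<open>n > 0\<close>] by metis
        then have "(int v - 1 + - int d) mod int n = (z + int d + - int d) mod int n"
          by (rule mod_add_cong) simp
        then have "u = vertex n (int v - 1 + - int d)"
          using 1 vertex_eq_iff[OF \<open>n > 0\<close>] by simp
        then show ?thesis using zd(2) by (intro image_eqI[of _ _ "- int d"]) auto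
      next
        case 2
        then have "(int v - 1) mod int n = z mod int n"
          using v vertex_eq_iff[OF \<open>n > 0\<close>] by metis
        then have "(int v - 1 + int d) mod int n = (z + int d) mod int n"
          by (rule mod_add_cong) simp
        then have "u = vertex n (int v - 1 + int d)"
          using 2 vertex_eq_iff[OF \<open>n > 0\<close>] by simp
        then show ?thesis using zd(2) by (intro image_eqI[of _ _ "int d"]) auto
      qed
    qed
  qed
  then have "card (closed_nbhd n k v) \<le> card ((\<lambda>d. vertex n (int v - 1 + d)) ` {- int k..int k})"
    by (intro card_mono) auto
  also have "\<dots> \<le> card {- int k..int k}" by (intro card_image_le) auto
  finally show ?thesis by simp
qed

section \<open>The lower bound\<close>

text \<open>Running from an arbitrary history over a list of offered vertices separates the last
  permutation from the earlier ones, as \<open>perm_space_conditional_bound\<close>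
  requires.\<close>

definition play :: "strategy \<Rightarrow> (nat \<times> nat) list \<Rightarrow> nat list \<Rightarrow> (nat \<times> nat) list" where
  "play S h xs = foldl (\<lambda>h v. h @ [(v, S h v)]) h xs"

lemma play_Nil [simp]: "play S h [] = h"
  by (simp add: play_def)

lemma play_snoc [simp]: "play S h (xs @ [v]) = play S h xs @ [(v, S (play S h xs) v)]"
  by (simp add: play_def)

lemma history_block:
  assumes "i \<le> n" "n \<ge> 1"
  shows "history n S \<pi> (k * n + i) = play S (history n S \<pi> (k * n)) (perm_prefix (\<pi> (Suc k)) i)"
  using assms(1)
proof (induction i)
  case (Suc i)
  have "(k * n + i) div n = k" using Suc.prems by simp
  then have "offered n \<pi> (Suc (k * n + i)) = \<pi> (Suc k) (Suc i)"
    by (simp add: offered_def)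
  then show ?case
    using Suc by (simp add: Let_def perm_prefix_Suc)
qed auto

lemma history_restrict:
  assumes "n \<ge> 1" "m \<le> k * n"
  shows "history n S (restrict \<pi> {1..k}) m = history n S \<pi> m"
  using assms(2)
proof (induction m)
  case (Suc m)
  have "m div n < k" using Suc.prems assms(1) by (simp add: less_mult_imp_div_less)
  then have off: "offered n (restrict \<pi> {1..k}) (Suc m) = offered n \<pi> (Suc m)"
    by (simp add: offered_def)
  have "history n S (restrict \<pi> {1..k}) m = history n S \<pi> m"
    by (rule Suc.IH) (use Suc.prems in simp)
  then show ?case by (simp only: history.simps Let_def off)
qed auto

section \<open>Degrees and the total deficit\<close>

text \<open>Multigraph degree: parallel edges count with multiplicity and a loop counts
  twice.\<close>

definition degree :: "(nat \<times> nat) list \<Rightarrow> nat \<Rightarrow> nat" where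
  "degree h w = count_list (map fst h) w + count_list (map snd h) w"

text \<open>Truncated subtraction is intended: surplus degree at one vertex does not make up for a
  shortage at another.\<close>

definition deficit :: "nat \<Rightarrow> nat \<Rightarrow> (nat \<times> nat) list \<Rightarrow> nat" where
  "deficit n l h = (\<Sum>w=1..n. l - degree h w)"

lemma degree_snoc: "degree (h @ [(v, u)]) w = degree h w + of_bool (v = w) + of_bool (u = w)"
  by (simp add: degree_def)

lemma sum_degree_le: "(\<Sum>w=1..n. degree h w) \<le> 2 * length h"
proof (induction h rule: rev_induct)
  case (snoc x h)
  obtain v u where x: "x = (v, u)" by fastforce
  have "(\<Sum>w=1..n. of_bool (y = w) :: nat) \<le> 1" for y
    by (simp add: of_bool_def sum.delta')
  from this[of v] this[of u] show ?case
    using snoc by (simp add: x degree_snoc sum.distrib)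
qed (simp add: degree_def)

text \<open>Each round raises the degree sum by at most 2. For l = 2 k + 1 and k n rounds this
  leaves a deficit of at least n.\<close>

lemma deficit_ge: "n * l \<le> deficit n l h + 2 * length h"
proof -
  have "n * l = (\<Sum>w=1..n. l)" by simp
  also have "\<dots> \<le> (\<Sum>w=1..n. (l - degree h w) + degree h w)"
    by (intro sum_mono) auto
  also have "\<dots> \<le> deficit n l h + 2 * length h"
    using sum_degree_le[of h n] by (simp add: sum.distrib deficit_def)
  finally show ?thesis .
qed

lemma deficit_snoc: "deficit n l h \<le> deficit n l (h @ [(v, u)]) + of_bool (degree h v < l) + 1"
proof -
  have "deficit n l h \<le> (\<Sum>w=1..n. (l - degree (h @ [(v, u)]) w)
      + (if v = w then of_bool (degree h v < l) else 0) + (if u = w then 1 else 0))"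
    unfolding deficit_def by (intro sum_mono) (auto simp: degree_snoc)
  also have "\<dots> \<le> deficit n l (h @ [(v, u)]) + of_bool (degree h v < l) + 1"
    by (simp add: sum.distrib deficit_def sum.delta')
  finally show ?thesis .
qed

text \<open>A deficient vertex contributes at least 1 to the deficit. Hence the next of n - i
  remaining vertices is deficient with probability at most the deficit divided by n - i.\<close>

lemma card_deficient_le:
  assumes "A \<subseteq> {1..n}"
  shows "(\<Sum>v\<in>A. of_bool (degree h v < l)) \<le> deficit n l h"
proof -
  have "(\<Sum>v\<in>A. of_bool (degree h v < l)) \<le> (\<Sum>v\<in>A. l - degree h v)"
    by (intro sum_mono) auto
  also have "\<dots> \<le> deficit n l h"
    unfolding deficit_def using assms by (intro sum_mono2) auto
  finally show ?thesis .
qed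

text \<open>Deleting all edges at \<open>w\<close> isolates it, so they cannot be fewer than
  \<open>l\<close>.\<close>

lemma edge_connected_degree:
  assumes "edge_connected n l E" "w \<in> {1..n}"
  shows "l \<le> card {e \<in> E. w \<in> e}"
proof (rule ccontr)
  assume "\<not> ?thesis"
  then have conn: "connected_graph n (E - {e \<in> E. w \<in> e})"
    using assms(1) unfolding edge_connected_def by auto
  define w' where "w' = (if w = 1 then 2 else (1::nat))"
  have w': "w' \<in> {1..n}" "w' \<noteq> w"
    using assms by (auto simp: edge_connected_def w'_def)
  have "(w, w') \<in> {(x, y). {x, y} \<in> E - {e \<in> E. w \<in> e}}\<^sup>*"
    using conn assms(2) w'(1) unfolding connected_graph_def by blast
  then show False
  proof (cases rule: converse_rtranclE)
    case base
    then show ?thesis using w'(2) by simp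
  next
    case (step y)
    then show ?thesis by blast
  qed
qed

lemma card_incident_le_degree:
  assumes "E \<subseteq> set (map (\<lambda>(v, u). {u, v}) h)"
  shows "card {e \<in> E. w \<in> e} \<le> degree h w"
proof -
  let ?h = "filter (\<lambda>(v, u). v = w \<or> u = w) h"
  have "{e \<in> E. w \<in> e} \<subseteq> set (map (\<lambda>(v, u). {u, v}) ?h)"
    using assms by auto
  then have "card {e \<in> E. w \<in> e} \<le> card (set (map (\<lambda>(v, u). {u, v}) ?h))"
    by (intro card_mono) auto
  also have "\<dots> \<le> length ?h"
    using card_length[of "map (\<lambda>(v, u). {u, v}) ?h"] by simp
  also have "\<dots> \<le> degree h w"
    by (induction h) (auto simp: degree_def)
  finally show ?thesis .
qed

lemma deficit_eq_0:
  assumes "edge_connected n l E" "E \<subseteq> set (map (\<lambda>(v, u). {u, v}) h)"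
  shows "deficit n l h = 0"
proof -
  have "l \<le> degree h w" if "w \<in> {1..n}" for w
    using edge_connected_degree[OF assms(1) that] card_incident_le_degree[OF assms(2), of w]
    by linarith
  then show ?thesis by (simp add: deficit_def)
qed

lemma set_history_mono: "i \<le> m \<Longrightarrow> set (history n S \<pi> i) \<subseteq> set (history n S \<pi> m)"
  by (induction m rule: dec_induct) (auto simp: Let_def)

text \<open>For i < n this is the difference of the harmonic numbers H(n - 1) and H(n - i - 1),
  close to ln (n / (n - i)). It compensates the drift of the deficit divided by the number of
  vertices left.\<close>

definition harmonic_tail :: "nat \<Rightarrow> nat \<Rightarrow> real" where
  "harmonic_tail n i = (\<Sum>j<i. 1 / (real n - real j - 1))"

text \<open>The bound ln x \<le> x - 1 at x = (m - 1) / m turns each term 1 / m into a telescoping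
  difference of logarithms.\<close>

lemma harmonic_tail_le:
  assumes "i + 1 < n"
  shows "harmonic_tail n i \<le> ln (real n) - ln (real n - real i - 1)"
  using assms
proof (induction i)
  case 0
  then show ?case by (simp add: harmonic_tail_def)
next
  case (Suc i)
  define m where "m = real n - real i - 1"
  have m: "m > 1" using Suc.prems by (simp add: m_def)
  have "ln ((m - 1) / m) \<le> (m - 1) / m - 1"
    using m by (intro ln_le_minus_one) auto
  moreover have "ln ((m - 1) / m) = ln (m - 1) - ln m" "(m - 1) / m - 1 = - (1 / m)"
    using m by (simp_all add: ln_div field_simps)
  ultimately have "1 / m \<le> ln m - ln (m - 1)" by linarith
  moreover have "harmonic_tail n i \<le> ln (real n) - ln m"
    using Suc by (simp add: m_def)
  moreover have "harmonic_tail n (Suc i) = harmonic_tail n i + 1 / m"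
    by (simp add: harmonic_tail_def m_def)
  moreover have "real n - real (Suc i) - 1 = m - 1" by (simp add: m_def)
  ultimately show ?case by (simp only:)
qed

lemma harmonic_tail_ge:
  assumes "i < n"
  shows "ln (real n) - ln (real n - real i) \<le> harmonic_tail n i"
  using assms
proof (induction i)
  case 0
  then show ?case by (simp add: harmonic_tail_def)
next
  case (Suc i)
  define m where "m = real n - real i"
  have m: "m > 1" using Suc.prems by (simp add: m_def)
  have "ln (m / (m - 1)) \<le> m / (m - 1) - 1"
    using m by (intro ln_le_minus_one) auto
  also have "m / (m - 1) - 1 = 1 / (m - 1)"
    using m by (simp add: field_simps)
  finally have "ln m - ln (m - 1) \<le> 1 / (m - 1)"
    using m by (simp add: ln_div)
  moreover have "ln (real n) - ln m \<le> harmonic_tail n i"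
    using Suc by (simp add: m_def)
  moreover have "harmonic_tail n (Suc i) = harmonic_tail n i + 1 / (m - 1)"
    by (simp add: harmonic_tail_def m_def)
  moreover have "real n - real (Suc i) = m - 1" by (simp add: m_def)
  ultimately show ?case by (simp only:)
qed

text \<open>With X the deficit after i further vertices, X / (n - i) +
  \<open>harmonic_tail n i\<close> starts at 1 or more and has nonnegative drift; if X = 0 after
  \<open>I\<close> vertices, it lies at least \<open>\<delta>\<close> below 1. The potential
  \<open>W\<close> is the square of the shortfall below 1.\<close>

lemma card_deficit_zero_le:
  assumes "I < n" "\<delta> > 0" "\<delta> \<le> 1 - harmonic_tail n I" and h0: "n \<le> deficit n l h0"
  shows "real (card {p. p permutes {1..n} \<and> deficit n l (play S h0 (perm_prefix p I)) = 0})
    \<le> real I * (1 / (real n - real I))\<^sup>2 / \<delta>\<^sup>2 * fact n"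
proof -
  define X where "X xs = real (deficit n l (play S h0 xs))" for xs
  define W where "W xs = (max 0 (1 - X xs / (real n - real (length xs)) -
      harmonic_tail n (length xs)))\<^sup>2" for xs
  show ?thesis
  proof (rule card_permutations_drift[where W = W])
    fix xs assume xs: "distinct xs" "set xs \<subseteq> {1..n}" "length xs < I"
    define N where "N = real n - real (length xs)"
    define A where "A = {1..n} - set xs"
    define B where "B v = real (of_bool (degree (play S h0 xs) v < l))" for v
    have N: "N - 1 \<ge> real n - real I" "N > 1" "real (n - length xs) = N"
      using xs(3) assms(1) by (auto simp: N_def)
    have cardA: "real (card A) = N" and finA: "finite A"
      using xs N(3) by (auto simp: A_def card_Diff_subset distinct_card)
    have X_snoc: "X xs - 1 - B v \<le> X (xs @ [v])" for v
    proof -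
      have "real (deficit n l (play S h0 xs)) \<le>
          real (deficit n l (play S h0 (xs @ [v])) + of_bool (degree (play S h0 xs) v < l) + 1)"
        using deficit_snoc by (subst of_nat_le_iff) simp
      then show ?thesis by (simp add: X_def B_def)
    qed
    have B01: "B v \<in> {0..1}" for v by (simp add: B_def)
    have X0: "X xs \<ge> 0" by (simp add: X_def)
    have W_snoc: "W (xs @ [v]) = (max 0 (1 - X (xs @ [v]) / (N - 1) -
        harmonic_tail n (length xs) - 1 / (N - 1)))\<^sup>2" for v
      by (simp add: W_def N_def harmonic_tail_def algebra_simps)
    have "(\<Sum>v\<in>A. W (xs @ [v])) \<le> N * (W xs + (1 / (real n - real I))\<^sup>2)"
    proof (cases "X xs \<ge> N + 1")
      \<comment> \<open>A round lowers X by at most 2, so afterwards the ratio is still at least 1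
        and the potential vanishes. As X is an integer, the other case has X \<le> N, which bounds
        the increments.\<close>
      case True
      have "W (xs @ [v]) = 0" for v
      proof -
        have "1 \<le> X (xs @ [v]) / (N - 1)"
          using X_snoc[of v] B01[of v] True N(2) by (simp add: field_simps)
        moreover have "0 \<le> harmonic_tail n (length xs)"
          using xs(3) assms(1) unfolding harmonic_tail_def by (intro sum_nonneg) auto
        moreover have "0 \<le> 1 / (N - 1)" using N(2) by simp
        ultimately have "1 - X (xs @ [v]) / (N - 1) - harmonic_tail n (length xs) - 1 / (N - 1) \<le> 0"
          by linarith
        then show ?thesis unfolding W_snoc by (simp only: max_absorb1) simp
      qed
      then show ?thesis using N(2) by (simp add: W_def)
    next
      case False
      have "X xs \<le> N"
      proof -
        have "real (deficit n l (play S h0 xs)) < real (n - length xs + 1)"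
          using False N(3) by (simp add: X_def)
        then show ?thesis unfolding X_def N(3)[symmetric] by (simp only: of_nat_less_iff of_nat_le_iff)
      qed
      then have q: "0 \<le> X xs / N" "X xs / N \<le> 1"
        using X0 N(2) by auto
      \<comment> \<open>An upper bound for the change of 1 - X / (n - i) -
        \<open>harmonic_tail n i\<close> when v is offered; \<open>B v\<close> records whether v was
        deficient.\<close>
      define d where "d v = (B v - X xs / N) / (N - 1)" for v
      have "(\<Sum>v\<in>A. W (xs @ [v])) \<le> real (card A) *
          ((max 0 (1 - X xs / N - harmonic_tail n (length xs)))\<^sup>2 + (1 / (real n - real I))\<^sup>2)"
      proof (rule sum_pos_part_square_le[where d = d])
        show "finite A" by fact
        fix v assume "v \<in> A"
        have "(X xs - 1 - B v) / (N - 1) \<le> X (xs @ [v]) / (N - 1)"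
          using X_snoc[of v] N(2) by (intro divide_right_mono) auto
        moreover have "(X xs - 1 - B v) / (N - 1) + 1 / (N - 1) = X xs / N - d v"
          using N(2) by (simp add: d_def field_simps)
        ultimately have "1 - X (xs @ [v]) / (N - 1) - harmonic_tail n (length xs) - 1 / (N - 1)
            \<le> 1 - X xs / N - harmonic_tail n (length xs) + d v"
          by linarith
        then show "W (xs @ [v]) \<le> (max 0 (1 - X xs / N - harmonic_tail n (length xs) + d v))\<^sup>2"
          unfolding W_snoc by (intro power_mono) auto
        have "\<bar>B v - X xs / N\<bar> \<le> 1" using q B01[of v] by auto
        then have "\<bar>d v\<bar> \<le> 1 / (N - 1)"
          using N(2) by (simp add: d_def divide_right_mono)
        also have "\<dots> \<le> 1 / (real n - real I)"
          using N assms(1) by (intro divide_left_mono) auto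
        finally show "\<bar>d v\<bar> \<le> 1 / (real n - real I)" .
      next
        have "real (\<Sum>v\<in>A. of_bool (degree (play S h0 xs) v < l)) \<le> X xs"
          unfolding X_def A_def by (subst of_nat_le_iff, intro card_deficient_le) auto
        then have "(\<Sum>v\<in>A. B v) \<le> X xs" by (simp add: B_def)
        moreover have "(\<Sum>v\<in>A. B v - X xs / N) = (\<Sum>v\<in>A. B v) - X xs"
          using N(2) by (simp add: sum_subtractf cardA)
        ultimately show "(\<Sum>v\<in>A. d v) \<le> 0"
          using N(2) by (simp add: d_def sum_divide_distrib[symmetric] divide_nonpos_pos)
      qed
      then show ?thesis by (simp add: cardA W_def N_def)
    qed
    then show "(\<Sum>v\<in>{1..n} - set xs. W (xs @ [v])) \<le>
        real (n - length xs) * (W xs + (1 / (real n - real I))\<^sup>2)"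
      by (simp add: A_def N(3))
  next
    show "W [] \<le> 0"
      using h0 assms(1) by (simp add: W_def X_def harmonic_tail_def field_simps)
  next
    fix p assume "p permutes {1..n}" "deficit n l (play S h0 (perm_prefix p I)) = 0"
    then have "W (perm_prefix p I) = (max 0 (1 - harmonic_tail n I))\<^sup>2"
      by (simp add: W_def X_def)
    also have "\<dots> \<ge> \<delta>\<^sup>2"
      using assms(2,3) by (intro power_mono) auto
    finally show "\<delta>\<^sup>2 \<le> W (perm_prefix p I)" .
  qed (use assms in \<open>auto simp: W_def\<close>)
qed

text \<open>The first k n rounds are conditioned on. Success within k n + I rounds forces deficit 0
  at their end, because the multigraph only grows.\<close>

lemma success_prob_le:
  assumes "1 \<le> n" "I < n" "\<delta> > 0" "\<delta> \<le> 1 - harmonic_tail n I"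
  shows "success_prob n (edge_connected_family n (2 * k + 1)) S (k * n + I)
    \<le> real I * (1 / (real n - real I))\<^sup>2 / \<delta>\<^sup>2"
proof -
  let ?l = "2 * k + 1"
  interpret prob_space "perm_space n" by (rule prob_space_perm_space)
  define Q where "Q a p \<longleftrightarrow> deficit n ?l (play S (history n S a (k * n)) (perm_prefix p I)) = 0" for a p
  have bound: "real (card {p. p permutes {1..n} \<and> Q a p}) \<le>
      real I * (1 / (real n - real I))\<^sup>2 / \<delta>\<^sup>2 * fact n" for a
    unfolding Q_def
  proof (rule card_deficit_zero_le)
    show "n \<le> deficit n ?l (history n S a (k * n))"
      using deficit_ge[of n ?l "history n S a (k * n)"] by (simp add: algebra_simps)
  qed fact+
  have "success_prob n (edge_connected_family n ?l) S (k * n + I) \<le>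
      measure (perm_space n) {\<pi> \<in> space (perm_space n). Q (restrict \<pi> {1..k}) (\<pi> (Suc k))}"
    unfolding success_prob_def
  proof (rule finite_measure_mono)
    show "{\<pi> \<in> space (perm_space n). Q (restrict \<pi> {1..k}) (\<pi> (Suc k))} \<in> events"
      using bound by (rule perm_space_conditional_bound)
    show "{\<pi> \<in> space (perm_space n). hitting_time n (edge_connected_family n ?l) S \<pi> \<le> enat (k * n + I)}
        \<subseteq> {\<pi> \<in> space (perm_space n). Q (restrict \<pi> {1..k}) (\<pi> (Suc k))}"
    proof safe
      fix \<pi> assume "hitting_time n (edge_connected_family n ?l) S \<pi> \<le> enat (k * n + I)"
      then obtain i E where "i \<le> k * n + I" "edge_connected n ?l E"
        and E: "E \<subseteq> set (map (\<lambda>(v, u). {u, v}) (history n S \<pi> i))"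
        unfolding hitting_time_le_iff edge_connected_family_def builder_multigraph_def by auto
      have "E \<subseteq> set (map (\<lambda>(v, u). {u, v}) (history n S \<pi> (k * n + I)))"
        using E set_history_mono[OF \<open>i \<le> k * n + I\<close>, of n S \<pi>] by auto
      with \<open>edge_connected n ?l E\<close> have "deficit n ?l (history n S \<pi> (k * n + I)) = 0"
        by (rule deficit_eq_0)
      then show "Q (restrict \<pi> {1..k}) (\<pi> (Suc k))"
        using assms(1,2) by (simp only: Q_def history_restrict history_block less_imp_le order_refl)
    qed
  qed
  also have "\<dots> \<le> real I * (1 / (real n - real I))\<^sup>2 / \<delta>\<^sup>2"
    using bound by (rule perm_space_conditional_bound)
  finally show ?thesis .
qed

section \<open>The upper bound\<close>

text \<open>\<open>drop (k * n)\<close> discards the first \<open>k\<close> blocks; a vertex is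
  covered once it has been offered or chosen after them.\<close>

definition uncovered :: "nat \<Rightarrow> nat \<Rightarrow> (nat \<times> nat) list \<Rightarrow> nat set" where
  "uncovered n k h = {1..n} - (fst ` set (drop (k * n) h) \<union> snd ` set (drop (k * n) h))"

definition non_nbrs :: "nat \<Rightarrow> nat \<Rightarrow> nat \<Rightarrow> nat set" where
  "non_nbrs n k v = {1..n} - closed_nbhd n k v"

text \<open>In block d, \<open>length h div n\<close> is d - 1, and since v has residue v - 1 the
  chosen vertex is v shifted by d. Afterwards an uncovered non-neighbour is preferred; failing that,
  any non-neighbour still gives a non-circulant edge without a loop. The default 1 only keeps the
  choice within range.\<close>

definition circulant_strategy :: "nat \<Rightarrow> nat \<Rightarrow> strategy" where
  "circulant_strategy n k h v =
    (if length h < k * n then vertex n (int v + int (length h div n))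
     else if uncovered n k h \<inter> non_nbrs n k v \<noteq> {} then SOME u. u \<in> uncovered n k h \<inter> non_nbrs n k v
     else if non_nbrs n k v \<noteq> {} then SOME u. u \<in> non_nbrs n k v
     else 1)"

lemma some_in: "A \<noteq> {} \<Longrightarrow> (SOME u. u \<in> A) \<in> A"
  by (rule someI_ex) blast

lemma circulant_strategy_uncovered:
  assumes "k * n \<le> length h" "uncovered n k h \<inter> non_nbrs n k v \<noteq> {}"
  shows "circulant_strategy n k h v \<in> uncovered n k h \<inter> non_nbrs n k v"
  using some_in[OF assms(2)] assms by (simp add: circulant_strategy_def)

lemma circulant_strategy_non_nbr:
  assumes "k * n \<le> length h" "non_nbrs n k v \<noteq> {}"
  shows "circulant_strategy n k h v \<in> non_nbrs n k v"
proof (cases "uncovered n k h \<inter> non_nbrs n k v = {}")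
  case True
  then show ?thesis using some_in[OF assms(2)] assms by (simp add: circulant_strategy_def)
next
  case False
  then show ?thesis using circulant_strategy_uncovered[OF assms(1)] by blast
qed

lemma circulant_strategy_in:
  assumes "n \<ge> 1"
  shows "circulant_strategy n k \<in> strategies n"
proof -
  have "circulant_strategy n k h v \<in> {1..n}" for h v
  proof (cases "length h < k * n")
    case True
    then show ?thesis using vertex_in[of n] assms by (simp add: circulant_strategy_def)
  next
    case False
    show ?thesis
    proof (cases "non_nbrs n k v = {}")
      case True
      with False assms show ?thesis by (simp add: circulant_strategy_def)
    next
      case False
      with \<open>\<not> length h < k * n\<close> have "circulant_strategy n k h v \<in> non_nbrs n k v"
        by (intro circulant_strategy_non_nbr) auto
      then show ?thesis by (simp add: non_nbrs_def)
    qed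
  qed
  then show ?thesis by (simp add: strategies_def)
qed

lemma closed_nbhd_sym: "u \<in> closed_nbhd n k v \<Longrightarrow> v \<in> {1..n} \<Longrightarrow> v \<in> closed_nbhd n k u"
  by (auto simp: closed_nbhd_def insert_commute)

lemma non_nbrs_nonempty:
  assumes "2 * k + 1 < n" "v \<in> {1..n}"
  shows "non_nbrs n k v \<noteq> {}"
proof
  assume "non_nbrs n k v = {}"
  then have "{1..n} \<subseteq> closed_nbhd n k v" by (simp add: non_nbrs_def)
  moreover have "finite (closed_nbhd n k v)" by (simp add: closed_nbhd_def)
  ultimately have "card {1..n} \<le> card (closed_nbhd n k v)" by (rule card_mono[rotated])
  then show False using card_closed_nbhd_le[OF assms(2), of k] assms(1) by simp
qed

lemma history_step_in:
  assumes "m < m'"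
  shows "(offered n \<pi> (Suc m), S (history n S \<pi> m) (offered n \<pi> (Suc m))) \<in> set (history n S \<pi> m')"
  using set_history_mono[of "Suc m" m' n S \<pi>] assms by (auto simp: Let_def)

text \<open>Every vertex is offered in each of the blocks 1 to \<open>k\<close>, and in block d the
  strategy joins it to its shift by d.\<close>

lemma circulant_subset_history:
  assumes "n \<ge> 1" "\<pi> \<in> space (perm_space n)"
  shows "circulant n k \<subseteq> (\<lambda>(v, u). {u, v}) ` set (history n (circulant_strategy n k) \<pi> (k * n))"
proof
  fix e assume "e \<in> circulant n k"
  then obtain z d where e: "e = {vertex n z, vertex n (z + int d)}" and d: "d \<in> {1..k}"
    by (auto simp: circulant_def)
  have "n > 0" using assms by simp
  define v where "v = vertex n z"
  have v: "v \<in> {1..n}" unfolding v_def by (rule vertex_in) fact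
  have "\<pi> d permutes {1..n}"
    using assms(2) d by (auto simp: perm_space_def space_PiM PiE_iff space_uniform_count_measure)
  then obtain j where j: "j \<in> {1..n}" "\<pi> d j = v"
    using v by (metis permutes_image imageE)
  define i where "i = j - 1"
  have i: "i < n" "\<pi> d (Suc i) = v" using j by (auto simp: i_def)
  \<comment> \<open>\<open>m\<close> counts the rounds before the one that offers \<open>v\<close>
    in block \<open>d\<close>; the position \<open>i\<close> inside the block starts at 0.\<close>
  define m where "m = (d - 1) * n + i"
  have m_div: "m div n = d - 1" using i by (simp add: m_def)
  have m_less: "m < k * n"
  proof -
    have "m < (d - 1) * n + n" using i by (auto simp: m_def)
    also have "\<dots> = d * n" using d by (cases d) auto
    also have "\<dots> \<le> k * n" using d by simp
    finally show ?thesis .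
  qed
  have "Suc m - (d - 1) * n = Suc i" by (simp add: m_def)
  then have off: "offered n \<pi> (Suc m) = v"
    using i d by (simp add: offered_def m_div)
  have "vertex n (int v + int (d - 1)) = vertex n (z + int d)"
  proof -
    have "(int v - 1) mod int n = z mod int n"
      using vertex_minus_1[OF v] vertex_eq_iff[OF \<open>n > 0\<close>] v_def by metis
    then have "(int v - 1 + int d) mod int n = (z + int d) mod int n"
      by (rule mod_add_cong) simp
    moreover have "int v - 1 + int d = int v + int (d - 1)" using d by auto
    ultimately show ?thesis by (simp only: vertex_eq_iff[OF \<open>n > 0\<close>])
  qed
  then have "circulant_strategy n k (history n (circulant_strategy n k) \<pi> m) v = vertex n (z + int d)"
    using m_less by (simp add: circulant_strategy_def m_div)
  then have "(v, vertex n (z + int d)) \<in> set (history n (circulant_strategy n k) \<pi> (k * n))"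
    using history_step_in[OF m_less, of n \<pi> "circulant_strategy n k"] unfolding off by simp
  then show "e \<in> (\<lambda>(v, u). {u, v}) ` set (history n (circulant_strategy n k) \<pi> (k * n))"
    by (rule rev_image_eqI) (auto simp: e v_def)
qed

lemma length_play [simp]: "length (play S h xs) = length h + length xs"
  by (induction xs rule: rev_induct) auto

lemma map_fst_drop_play:
  assumes "length h = m"
  shows "map fst (drop m (play S h xs)) = xs"
  using assms by (induction xs rule: rev_induct) auto

lemma uncovered_snoc:
  assumes "k * n \<le> length h"
  shows "uncovered n k (h @ [(v, u)]) = uncovered n k h - {v, u}"
  using assms by (auto simp: uncovered_def)

text \<open>Unless Builder is blocked, the chosen vertex is uncovered and differs from v, so the
  losses at the two endpoints add up. Real numbers avoid truncated subtraction.\<close>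

lemma card_uncovered_play_snoc:
  assumes "k * n \<le> length h"
  shows "real (card (uncovered n k (h @ [(v, circulant_strategy n k h v)]))) \<le>
    real (card (uncovered n k h)) - 1 - of_bool (v \<in> uncovered n k h)
      + of_bool (uncovered n k h \<inter> non_nbrs n k v = {})"
proof -
  define U where "U = uncovered n k h"
  define u where "u = circulant_strategy n k h v"
  have fin: "finite U" by (simp add: U_def uncovered_def)
  have eq: "uncovered n k (h @ [(v, u)]) = U - {v, u}"
    unfolding U_def using assms by (rule uncovered_snoc)
  show ?thesis
  proof (cases "U \<inter> non_nbrs n k v = {}")
    case True
    have "card (U - {v, u}) \<le> card (U - {v})"
      using fin by (intro card_mono) auto
    also have "real (card (U - {v})) = real (card U) - of_bool (v \<in> U)"
      using fin card_gt_0_iff[of U] by (auto simp: card_Diff_singleton_if)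
    finally show ?thesis using True eq by (simp add: U_def u_def)
  next
    case False
    then have "u \<in> U" "u \<in> non_nbrs n k v"
      using circulant_strategy_uncovered[OF assms] by (auto simp: U_def u_def)
    then have "u \<noteq> v" by (auto simp: non_nbrs_def closed_nbhd_def)
    have "U - {v, u} = (U - {u}) - {v}" by auto
    then have "card (U - {v, u}) + of_bool (v \<in> U) + 1 = card U"
      using fin \<open>u \<in> U\<close> \<open>u \<noteq> v\<close> card_Suc_Diff1[of U u] card_Suc_Diff1[of "U - {u}" v] by auto
    then have "real (card U) = real (card (U - {v, u}) + of_bool (v \<in> U) + 1)" by (simp only:)
    then show ?thesis using False eq by (simp add: U_def u_def)
  qed
qed

text \<open>When v blocks Builder, all uncovered vertices lie in the closed neighbourhood of v. For
  one fixed uncovered \<open>u\<close> this puts v into the closed neighbourhood of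
  \<open>u\<close>, which has at most 2 k + 1 elements.\<close>

lemma sum_no_choice_le:
  assumes "u \<in> U" "U \<subseteq> {1..n}" "A \<subseteq> {1..n}"
  shows "(\<Sum>v\<in>A. of_bool (U \<inter> non_nbrs n k v = {})) \<le> 2 * real k + 1"
proof -
  have finA: "finite A" using assms(3) finite_subset by blast
  have "{v \<in> A. U \<inter> non_nbrs n k v = {}} \<subseteq> closed_nbhd n k u"
    using assms closed_nbhd_sym[of u n k] unfolding non_nbrs_def by blast
  then have "card {v \<in> A. U \<inter> non_nbrs n k v = {}} \<le> card (closed_nbhd n k u)"
    by (intro card_mono) (auto simp: closed_nbhd_def)
  also have "\<dots> \<le> 2 * k + 1"
    using assms by (intro card_closed_nbhd_le) auto
  finally have "real (card {v \<in> A. U \<inter> non_nbrs n k v = {}}) \<le> 2 * real k + 1" by simp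
  then show ?thesis
    using finA by (simp add: of_bool_def sum.If_cases Int_def)
qed

lemma card_le_if_no_choice:
  assumes "v \<in> {1..n}" "U \<subseteq> {1..n}" "U \<inter> non_nbrs n k v = {}"
  shows "card U \<le> 2 * k + 1"
proof -
  have "U \<subseteq> closed_nbhd n k v" using assms by (auto simp: non_nbrs_def)
  then have "card U \<le> card (closed_nbhd n k v)"
    by (intro card_mono) (auto simp: closed_nbhd_def)
  then show ?thesis using card_closed_nbhd_le[OF assms(1), of k] by simp
qed

text \<open>Mirror image of the lower bound: \<open>\<psi> X\<close> / (n - i) +
  \<open>harmonic_tail n i\<close> starts at 1 or less and has nonpositive drift while uncovered
  vertices remain. If some remain after \<open>I\<close> vertices, \<open>\<psi>\<close> is at least
  -L / 2 and the process exceeds 1 by at least \<open>\<delta>\<close>. \<open>W\<close> is 0 once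
  all are covered, since the drift estimate relies on an uncovered vertex.\<close>

lemma card_uncovered_nonempty_le:
  assumes I: "I < n" "3 * (2 * real k + 1) \<le> real n - real I"
    and "\<delta> > 0" "\<delta> \<le> harmonic_tail n I - 1 - (2 * real k + 1) / 2 / (real n - real I)"
    and h0: "length h0 = k * n"
  shows "real (card {p. p permutes {1..n} \<and>
      uncovered n k (play (circulant_strategy n k) h0 (perm_prefix p I)) \<noteq> {}})
    \<le> real I * (3 / (real n - real I))\<^sup>2 / \<delta>\<^sup>2 * fact n"
proof -
  define L where "L = 2 * real k + 1"
  define U where "U xs = uncovered n k (play (circulant_strategy n k) h0 xs)" for xs
  define X where "X xs = real (card (U xs))" for xs
  \<comment> \<open>Below \<open>L\<close> a round makes progress only with probability at least \<open>2/3\<close>; the slope \<open>3/2\<close>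
    restores the drift of a round without obstruction.\<close>
  define \<psi> where "\<psi> x = min x ((3 * x - L) / 2)" for x :: real
  define W where "W xs = (if U xs = {} then 0 else (max 0 (\<psi> (X xs) / (real n - real (length xs)) +
      harmonic_tail n (length xs) - 1))\<^sup>2)" for xs
  have U_sub: "U xs \<subseteq> {1..n} - set xs" for xs
  proof -
    have "fst ` set (drop (k * n) (play (circulant_strategy n k) h0 xs)) = set xs"
      using map_fst_drop_play[OF h0, of "circulant_strategy n k" xs] by (metis list.set_map)
    then show ?thesis by (auto simp: U_def uncovered_def)
  qed
  have finU: "finite (U xs)" for xs by (simp add: U_def uncovered_def)
  have L0: "L \<ge> 1" by (simp add: L_def)
  show ?thesis
    unfolding U_def[symmetric]
  proof (rule card_permutations_drift[where W = W])
    fix xs assume xs: "distinct xs" "set xs \<subseteq> {1..n}" "length xs < I"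
    define N where "N = real n - real (length xs)"
    define A where "A = {1..n} - set xs"
    define B where "B v = (of_bool (v \<in> U xs) :: real)" for v
    define F where "F v = (of_bool (U xs \<inter> non_nbrs n k v = {}) :: real)" for v
    have N: "N - 1 \<ge> real n - real I" "N > 1" "real (n - length xs) = N" "3 * L \<le> N"
      using xs(3) I by (auto simp: N_def L_def)
    have cardA: "real (card A) = N" and finA: "finite A"
      using xs N(3) by (auto simp: A_def card_Diff_subset distinct_card)
    have "(\<Sum>v\<in>A. W (xs @ [v])) \<le> N * (W xs + (3 / (real n - real I))\<^sup>2)"
    proof (cases "U xs = {}")
      case True
      then have "U (xs @ [v]) = {}" for v
        using h0 by (simp add: U_def uncovered_snoc)
      then show ?thesis using N(2) True by (simp add: W_def)
    next
      case False
      then obtain u where u: "u \<in> U xs" by blast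
      have X_snoc: "X (xs @ [v]) \<le> X xs - (1 + B v - F v)" for v
        using card_uncovered_play_snoc[of k n "play (circulant_strategy n k) h0 xs" v] h0
        by (simp add: X_def U_def B_def F_def)
      have B01: "B v = 0 \<or> B v = 1" and F01: "F v = 0 \<or> F v = 1" for v
        by (auto simp: B_def F_def)
      have sumB: "(\<Sum>v\<in>A. B v) = X xs"
        using finA U_sub[of xs] by (simp add: B_def X_def of_bool_def sum.If_cases A_def Int_absorb1)
      have sumF: "(\<Sum>v\<in>A. F v) \<le> L"
        unfolding F_def L_def using u U_sub[of xs] by (intro sum_no_choice_le) (auto simp: A_def)
      \<comment> \<open>More than \<open>L\<close> uncovered vertices do not fit into one closed
        neighbourhood, so no offer can block.\<close>
      have F0: "F v = 0" if "X xs > L" "v \<in> A" for v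
        using card_le_if_no_choice[of v n "U xs" k] U_sub[of xs] that
        by (auto simp: F_def X_def L_def A_def)
      have "card (U xs) \<le> card A"
        using U_sub[of xs] finA by (intro card_mono) (auto simp: A_def)
      then have XN: "0 \<le> X xs" "X xs \<le> N"
        using cardA by (auto simp: X_def)
      \<comment> \<open>\<open>\<psi>\<close> is concave, being a minimum of two linear functions,
        so it drops by at least 1 + B - F times the slope of the branch active at
        \<open>X xs\<close>.\<close>
      define D where "D v = (if X xs > L then 1 else 3 / 2) * (1 + B v - F v)" for v
      define d where "d v = (\<psi> (X xs) / N + 1 - D v) / (N - 1)" for v
      have \<psi>_snoc: "\<psi> (X (xs @ [v])) \<le> \<psi> (X xs) - D v" for v
        using X_snoc[of v] by (auto simp: \<psi>_def D_def min_def field_simps)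
      have "\<psi> (X xs) \<le> N" "- N \<le> \<psi> (X xs)"
        using XN N L0 by (auto simp: \<psi>_def min_def)
      then have q: "\<psi> (X xs) / N \<le> 1" "- 1 \<le> \<psi> (X xs) / N"
        using N(2) by (auto simp: field_simps)
      have "(\<Sum>v\<in>A. W (xs @ [v])) \<le> real (card A) *
          ((max 0 (\<psi> (X xs) / N + harmonic_tail n (length xs) - 1))\<^sup>2 + (3 / (real n - real I))\<^sup>2)"
      proof (rule sum_pos_part_square_le[where d = d])
        show "finite A" by fact
        fix v assume v: "v \<in> A"
        have "\<psi> (X (xs @ [v])) / (N - 1) \<le> (\<psi> (X xs) - D v) / (N - 1)"
          using \<psi>_snoc[of v] N(2) by (intro divide_right_mono) auto
        moreover have "(\<psi> (X xs) - D v) / (N - 1) + 1 / (N - 1) = \<psi> (X xs) / N + d v"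
          using N(2) by (simp add: d_def field_simps)
        ultimately have "\<psi> (X (xs @ [v])) / (N - 1) + (harmonic_tail n (length xs) + 1 / (N - 1)) - 1
            \<le> \<psi> (X xs) / N + harmonic_tail n (length xs) - 1 + d v"
          by linarith
        then have "(max 0 (\<psi> (X (xs @ [v])) / (N - 1) + (harmonic_tail n (length xs) + 1 / (N - 1)) - 1))\<^sup>2
            \<le> (max 0 (\<psi> (X xs) / N + harmonic_tail n (length xs) - 1 + d v))\<^sup>2"
          by (intro power_mono) auto
        moreover have "real n - real (length (xs @ [v])) = N - 1"
          "harmonic_tail n (length (xs @ [v])) = harmonic_tail n (length xs) + 1 / (N - 1)"
          by (simp_all add: N_def harmonic_tail_def)
        ultimately show "W (xs @ [v]) \<le>
            (max 0 (\<psi> (X xs) / N + harmonic_tail n (length xs) - 1 + d v))\<^sup>2"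
          unfolding W_def by (simp only: if_split) simp
        \<comment> \<open>At most two vertices are covered per round and the slope is at most 3/2;
          this is the source of the constant 3.\<close>
        have "0 \<le> D v" "D v \<le> 3"
          using B01[of v] F01[of v] by (auto simp: D_def)
        then have "\<bar>\<psi> (X xs) / N + 1 - D v\<bar> \<le> 3" using q by linarith
        then have "\<bar>d v\<bar> \<le> 3 / (N - 1)"
          using N(2) by (simp add: d_def divide_right_mono)
        also have "\<dots> \<le> 3 / (real n - real I)"
          using N I(1) by (intro divide_left_mono) auto
        finally show "\<bar>d v\<bar> \<le> 3 / (real n - real I)" .
      next
        have "\<psi> (X xs) + N \<le> (\<Sum>v\<in>A. D v)"
        proof (cases "X xs > L")
          case True
          then have "(\<Sum>v\<in>A. D v) = (\<Sum>v\<in>A. 1 + B v)"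
            using F0 by (intro sum.cong) (auto simp: D_def)
          also have "\<dots> = N + X xs" by (simp add: sum.distrib cardA sumB)
          finally show ?thesis by (simp add: \<psi>_def)
        next
          \<comment> \<open>At slope 3/2 the sum of \<open>D\<close> exceeds X + N by at least (X +
            N - 3 L) / 2, which is nonnegative because N \<ge> 3 L.\<close>
          case False
          then have "(\<Sum>v\<in>A. D v) = 3 / 2 * (\<Sum>v\<in>A. 1 + B v - F v)"
            by (simp only: D_def sum_distrib_left if_False)
          also have "(\<Sum>v\<in>A. 1 + B v - F v) = N + X xs - (\<Sum>v\<in>A. F v)"
            by (simp add: sum.distrib sum_subtractf cardA sumB)
          finally have "(\<Sum>v\<in>A. D v) = 3 / 2 * (N + X xs - (\<Sum>v\<in>A. F v))" .
          moreover have "\<psi> (X xs) \<le> X xs" by (simp add: \<psi>_def)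
          moreover have "p + N \<le> s" if "s = 3 / 2 * (N + X xs - t)" "p \<le> X xs" "t \<le> L" for s t p
            using that N(4) XN(1) by argo
          ultimately show ?thesis using sumF by blast
        qed
        moreover have "(\<Sum>v\<in>A. \<psi> (X xs) / N + 1 - D v) = \<psi> (X xs) + N - (\<Sum>v\<in>A. D v)"
          using N(2) by (simp add: sum_subtractf sum.distrib cardA distrib_left)
        ultimately show "(\<Sum>v\<in>A. d v) \<le> 0"
          using N(2) by (simp add: d_def sum_divide_distrib[symmetric] divide_nonpos_pos)
      qed
      then show ?thesis using False by (simp add: cardA W_def N_def)
    qed
    then show "(\<Sum>v\<in>{1..n} - set xs. W (xs @ [v])) \<le>
        real (n - length xs) * (W xs + (3 / (real n - real I))\<^sup>2)"
      by (simp add: A_def N(3))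
  next
    have "X [] = real n" by (simp add: X_def U_def uncovered_def h0)
    then have "\<psi> (X []) / real n \<le> 1"
      using I by (simp add: \<psi>_def)
    then show "W [] \<le> 0"
      by (simp add: W_def harmonic_tail_def)
  next
    fix p assume "p permutes {1..n}" and ne: "U (perm_prefix p I) \<noteq> {}"
    have "- (L / 2) \<le> \<psi> (X (perm_prefix p I))"
      using L0 by (auto simp: \<psi>_def X_def min_def)
    then have "- (L / 2) / (real n - real I) \<le> \<psi> (X (perm_prefix p I)) / (real n - real I)"
      using I(1) by (intro divide_right_mono) auto
    then have "\<delta> \<le> \<psi> (X (perm_prefix p I)) / (real n - real I) + harmonic_tail n I - 1"
      using assms(4) by (simp add: L_def)
    then show "\<delta>\<^sup>2 \<le> W (perm_prefix p I)"
      using ne assms(3) unfolding W_def by (auto intro!: power_mono)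
  qed (use assms in \<open>auto simp: W_def\<close>)
qed

text \<open>Since 2 k + 1 < n some non-neighbour is always available, so even a blocked round gives
  an edge that is neither a loop nor in the circulant graph.\<close>

lemma drop_play_non_nbr:
  assumes "2 * k + 1 < n" "length h0 = k * n" "set xs \<subseteq> {1..n}"
    and "(v, u) \<in> set (drop (k * n) (play (circulant_strategy n k) h0 xs))"
  shows "u \<in> non_nbrs n k v"
  using assms(3,4)
proof (induction xs rule: rev_induct)
  case (snoc x xs)
  let ?h = "play (circulant_strategy n k) h0 xs"
  have "circulant_strategy n k ?h x \<in> non_nbrs n k x"
    using snoc.prems(1) assms(1,2)
    by (intro circulant_strategy_non_nbr non_nbrs_nonempty) auto
  with snoc assms(2) show ?case by auto
qed (use assms(2) in auto)

text \<open>The first \<open>k\<close> blocks contain the circulant graph, and once all vertices are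
  covered, each lies on a later edge outside it, so
  \<open>edge_connected_circulant_extension\<close> applies.\<close>

lemma circulant_strategy_success:
  assumes "2 \<le> k" "2 * k + 1 < n" "I \<le> n" "\<pi> \<in> space (perm_space n)"
    and cov: "uncovered n k (history n (circulant_strategy n k) \<pi> (k * n + I)) = {}"
  shows "hitting_time n (edge_connected_family n (2 * k + 1)) (circulant_strategy n k) \<pi>
    \<le> enat (k * n + I)"
proof -
  let ?S = "circulant_strategy n k"
  let ?h = "history n ?S \<pi> (k * n + I)"
  let ?edges = "(\<lambda>(v, u). {u, v}) ` set ?h"
  define E where "E = {e \<in> ?edges. card e = 2}"
  have "n \<ge> 1" using assms by simp
  have sub: "set ?h \<subseteq> {1..n} \<times> {1..n}"
    using \<open>n \<ge> 1\<close> circulant_strategy_in[OF \<open>n \<ge> 1\<close>] assms(4) by (rule set_history)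
  have lab: "labeled_graph n E"
    using sub unfolding labeled_graph_def E_def by auto
  have "circulant n k \<subseteq> ?edges"
    using circulant_subset_history[OF \<open>n \<ge> 1\<close> assms(4)]
      image_mono[OF set_history_mono[OF le_add1]] by (rule order_trans)
  then have circ: "circulant n k \<subseteq> E"
    using labeled_graph_circulant[of k n] assms(2) by (auto simp: E_def labeled_graph_def)
  have perm: "\<pi> (Suc k) permutes {1..n}"
    using assms(4) by (auto simp: perm_space_def space_PiM PiE_iff space_uniform_count_measure)
  have new: "{u, v} \<in> E - circulant n k" if "(v, u) \<in> set (drop (k * n) ?h)" for v u
  proof -
    have "(v, u) \<in> set ?h" using that by (rule in_set_dropD)
    have "u \<in> non_nbrs n k v"
    proof (rule drop_play_non_nbr[OF assms(2)])
      show "(v, u) \<in> set (drop (k * n) (play ?S (history n ?S \<pi> (k * n)) (perm_prefix (\<pi> (Suc k)) I)))"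
        using that unfolding history_block[OF assms(3) \<open>n \<ge> 1\<close>] .
      show "set (perm_prefix (\<pi> (Suc k)) I) \<subseteq> {1..n}"
        by (rule perm_prefix_props(2)[OF perm assms(3)])
    qed simp
    then have "u \<noteq> v" "{u, v} \<notin> circulant n k"
      by (auto simp: non_nbrs_def closed_nbhd_def)
    then show ?thesis using \<open>(v, u) \<in> set ?h\<close> by (force simp: E_def)
  qed
  have "edge_connected n (2 * k + 1) E"
  proof (rule edge_connected_circulant_extension)
    show "finite E" by (simp add: E_def)
    fix w assume "w \<in> {1..n}"
    then have "w \<in> fst ` set (drop (k * n) ?h) \<union> snd ` set (drop (k * n) ?h)"
      using cov by (auto simp: uncovered_def)
    then obtain v u where vu: "(v, u) \<in> set (drop (k * n) ?h)" "w \<in> {u, v}" by force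
    then show "\<exists>e\<in>E - circulant n k. w \<in> e" using new[OF vu(1)] by blast
  qed (use assms lab circ in auto)
  then have "E \<in> edge_connected_family n (2 * k + 1)"
    using lab by (simp add: edge_connected_family_def)
  moreover have "E \<subseteq> set_mset (builder_multigraph n ?S \<pi> (k * n + I))"
    by (auto simp: builder_multigraph_def E_def)
  ultimately show ?thesis
    unfolding hitting_time_le_iff by blast
qed

text \<open>Every sequence of permutations leads to success or leaves an uncovered vertex; the
  latter is bounded conditionally on the first \<open>k\<close> permutations.\<close>

lemma success_prob_ge:
  assumes "2 \<le> k" "I < n" "3 * (2 * real k + 1) \<le> real n - real I"
    and "\<delta> > 0" "\<delta> \<le> harmonic_tail n I - 1 - (2 * real k + 1) / 2 / (real n - real I)"
  shows "1 - real I * (3 / (real n - real I))\<^sup>2 / \<delta>\<^sup>2 \<le>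
    success_prob n (edge_connected_family n (2 * k + 1)) (circulant_strategy n k) (k * n + I)"
proof -
  let ?S = "circulant_strategy n k"
  let ?F = "edge_connected_family n (2 * k + 1)"
  let ?b = "real I * (3 / (real n - real I))\<^sup>2 / \<delta>\<^sup>2"
  interpret prob_space "perm_space n" by (rule prob_space_perm_space)
  have n: "1 \<le> n" "2 * k + 1 < n" "I \<le> n" using assms(1-3) by auto
  define Q where "Q a p \<longleftrightarrow> uncovered n k (play ?S (history n ?S a (k * n)) (perm_prefix p I)) \<noteq> {}" for a p
  have bound: "real (card {p. p permutes {1..n} \<and> Q a p}) \<le> ?b * fact n" for a
    unfolding Q_def using assms by (intro card_uncovered_nonempty_le) auto
  let ?G = "{\<pi> \<in> space (perm_space n). hitting_time n ?F ?S \<pi> \<le> enat (k * n + I)}"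
  let ?B = "{\<pi> \<in> space (perm_space n). Q (restrict \<pi> {1..k}) (\<pi> (Suc k))}"
  have "space (perm_space n) \<subseteq> ?G \<union> ?B"
  proof
    fix \<pi> assume \<pi>: "\<pi> \<in> space (perm_space n)"
    have "hitting_time n ?F ?S \<pi> \<le> enat (k * n + I)" if "\<not> Q (restrict \<pi> {1..k}) (\<pi> (Suc k))"
      using assms(1) n(2,3) \<pi>
    proof (rule circulant_strategy_success)
      show "uncovered n k (history n ?S \<pi> (k * n + I)) = {}"
        using that unfolding Q_def history_restrict[OF n(1) order_refl] history_block[OF n(3,1)]
        by blast
    qed
    with \<pi> show "\<pi> \<in> ?G \<union> ?B" by blast
  qed
  moreover have "?B \<in> events" using bound by (rule perm_space_conditional_bound)
  moreover have "?G \<in> events" by (rule success_event_measurable)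
  ultimately have "prob (space (perm_space n)) \<le> prob ?G + prob ?B"
    by (meson finite_measure_mono measure_Un_le order_trans sets.Un)
  moreover have "prob ?B \<le> ?b" using bound by (rule perm_space_conditional_bound)
  ultimately show ?thesis by (simp add: success_prob_def prob_space)
qed

section \<open>Hitting times\<close>

text \<open>The constant 36 is 9 times 4: n - I is at least n / 3 and \<open>\<delta>\<close> is at
  least f / (2 n). When \<open>I\<close> is 0, the general bound is already 0.\<close>

lemma success_prob_lower_bound:
  fixes n k f :: nat
  assumes n: "n \<ge> 1" and f: "f \<ge> 4"
    and I: "I = nat \<lceil>(1 - 1 / exp 1) * real n - real f\<rceil>"
  shows "success_prob n (edge_connected_family n (2 * k + 1)) S (k * n + I)
    \<le> 36 * real n / (real f)\<^sup>2"
proof (cases "I = 0")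
  case True
  have "success_prob n (edge_connected_family n (2 * k + 1)) S (k * n + I)
    \<le> real I * (1 / (real n - real I))\<^sup>2 / 1\<^sup>2"
    using n True by (intro success_prob_le) (auto simp: harmonic_tail_def)
  then show ?thesis using True by (simp add: order_trans[of _ 0])
next
  case False
  define e where "e = exp (1::real)"
  have e: "e \<ge> 2" "e \<le> 3"
    using exp_ge_add_one_self[of 1] exp_le by (auto simp: e_def)
  \<comment> \<open>Of \<open>f\<close>, one unit is lost to rounding \<open>I\<close> up and one to
    the -1 in \<open>harmonic_tail_le\<close>.\<close>
  define \<delta> where "\<delta> = (real f - 2) / real n"
  have \<delta>0: "\<delta> > 0" using n f by (simp add: \<delta>_def)
  have "real I < (1 - 1 / e) * real n - real f + 1"
    using False unfolding I e_def by linarith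
  then have r: "real n - real I - 1 > real n / e + (real f - 2)"
    by (simp add: algebra_simps)
  have pos: "(1 - 1 / e) * real n - real f > 0"
    using False unfolding I e_def by linarith
  have "real n / e > 0" using n e by simp
  then have I_less: "I + 1 < n" using r f by linarith
  have "\<delta> \<le> 1 - 1 / e"
    using pos n by (simp add: \<delta>_def field_simps)
  then have "1 + e * \<delta> \<le> e"
    using e by (simp add: field_simps)
  \<comment> \<open>The plan is ln y \<ge> 1 - 1 / y at y = 1 + e \<delta>; the right side is e
    \<delta> / (1 + e \<delta>), at least \<delta> because 1 + e \<delta> \<le> e.\<close>
  have "\<delta> \<le> 1 - 1 / (1 + e * \<delta>)"
  proof -
    have "\<delta> * (1 + e * \<delta>) \<le> \<delta> * e"
      using \<open>1 + e * \<delta> \<le> e\<close> \<delta>0 by (intro mult_left_mono) auto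
    moreover have "1 + e * \<delta> > 0" using e \<delta>0 by (intro add_pos_nonneg) auto
    ultimately show ?thesis by (simp add: field_simps)
  qed
  also have "\<dots> \<le> ln (1 + e * \<delta>)"
  proof -
    have p: "1 + e * \<delta> > 0" using e \<delta>0 by (intro add_pos_nonneg) auto
    then have "ln (1 / (1 + e * \<delta>)) \<le> 1 / (1 + e * \<delta>) - 1"
      by (intro ln_le_minus_one) auto
    then show ?thesis using p by (simp add: ln_div)
  qed
  also have "\<dots> \<le> ln (e * ((real n - real I - 1) / real n))"
  proof (subst ln_le_cancel_iff)
    have "e * ((real n / e + (real f - 2)) / real n) \<le> e * ((real n - real I - 1) / real n)"
      using r e n by (intro mult_left_mono divide_right_mono) auto
    moreover have "e * ((real n / e + (real f - 2)) / real n) = 1 + e * \<delta>"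
      using e n by (simp add: \<delta>_def field_simps)
    ultimately show "1 + e * \<delta> \<le> e * ((real n - real I - 1) / real n)" by simp
    show "1 + e * \<delta> > 0" using e \<delta>0 by (intro add_pos_nonneg) auto
    then show "0 < e * ((real n - real I - 1) / real n)"
      using \<open>1 + e * \<delta> \<le> e * ((real n - real I - 1) / real n)\<close> by linarith
  qed
  also have "\<dots> = 1 + ln (real n - real I - 1) - ln (real n)"
    using I_less n by (subst ln_mult) (auto simp: e_def ln_div)
  also have "\<dots> \<le> 1 - harmonic_tail n I"
    using harmonic_tail_le[OF I_less] by linarith
  finally have "success_prob n (edge_connected_family n (2 * k + 1)) S (k * n + I)
    \<le> real I * (1 / (real n - real I))\<^sup>2 / \<delta>\<^sup>2"
    using n I_less \<delta>0 by (intro success_prob_le) auto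
  also have "\<dots> \<le> real n * (3 / real n)\<^sup>2 / (real f / 2 / real n)\<^sup>2"
  proof (rule frac_le)
    have "real n / 3 \<le> real n / e" using e n by (intro divide_left_mono) auto
    then have "real n / 3 \<le> real n - real I" using r f by linarith
    then have "1 / (real n - real I) \<le> 3 / real n"
      using n I_less by (simp add: field_simps)
    then show "real I * (1 / (real n - real I))\<^sup>2 \<le> real n * (3 / real n)\<^sup>2"
      using I_less by (intro mult_mono power_mono) auto
    have "real f / 2 / real n \<le> \<delta>"
      using f n unfolding \<delta>_def by (intro divide_right_mono) auto
    then show "(real f / 2 / real n)\<^sup>2 \<le> \<delta>\<^sup>2"
      by (intro power_mono) auto
  qed (use n f in auto)
  also have "\<dots> = 36 * real n / (real f)\<^sup>2"
    using n f by (simp add: field_simps power2_eq_square)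
  finally show ?thesis .
qed

text \<open>The extra 2 k rounds pay for blocking: since e \<ge> 2, the offset 2 k + g raises
  \<open>harmonic_tail n I\<close> above 1 by at least 2 (2 k + g - 1) / n, of which at most (4 k +
  2) / n is spent on the blocking term. The remaining (2 g - 4) / n is at least g / n as g \<ge> 4.
  The constant 144 is 12 squared, from n - I \<ge> n / 4.\<close>

lemma success_prob_upper_bound:
  fixes n k g :: nat
  assumes k: "k \<ge> 2" and g: "g \<ge> 4" and small: "2 * real k + real g \<le> real n / 20"
    and I: "I = nat \<lfloor>(1 - 1 / exp 1) * real n + 2 * real k + real g\<rfloor>"
  shows "1 - 144 * real n / (real g)\<^sup>2 \<le>
    success_prob n (edge_connected_family n (2 * k + 1)) (circulant_strategy n k) (k * n + I)"
proof -
  define e where "e = exp (1::real)"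
  have e: "e \<ge> 2" "e \<le> 3"
    using exp_ge_add_one_self[of 1] exp_le by (auto simp: e_def)
  have n: "real n > 0" using small k by linarith
  define \<delta> where "\<delta> = real g / real n"
  have \<delta>0: "\<delta> > 0" using n g by (simp add: \<delta>_def)
  have "(1 - 1 / e) * real n \<ge> 0" using e by simp
  then have "real I \<le> (1 - 1 / e) * real n + 2 * real k + real g"
    "real I > (1 - 1 / e) * real n + 2 * real k + real g - 1"
    unfolding I e_def by linarith+
  then have r: "real n - real I \<ge> real n / e - (2 * real k + real g)"
    "real n - real I \<le> real n / e - (2 * real k + real g) + 1"
    by (simp_all add: algebra_simps)
  have "real n / 3 \<le> real n / e" using e n by (intro divide_left_mono) auto
  then have r4: "real n - real I \<ge> real n / 4" using r small n by linarith
  then have rpos: "real n - real I > 0" using n by linarith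
  have "ln (e * (real n - real I) / real n) \<le> e * (real n - real I) / real n - 1"
    using e n rpos by (intro ln_le_minus_one) auto
  moreover have "ln (e * (real n - real I) / real n) = 1 + ln (real n - real I) - ln (real n)"
    using e n rpos by (simp add: ln_div ln_mult) (simp add: e_def)
  moreover have "e * (real n - real I) / real n \<le> 1 - 2 * (2 * real k + real g - 1) / real n"
  proof -
    have "e * (real n - real I) \<le> e * (real n / e - (2 * real k + real g) + 1)"
      using r e by (intro mult_left_mono) auto
    also have "\<dots> = real n - e * (2 * real k + real g - 1)"
      using e by (simp add: algebra_simps)
    also have "\<dots> \<le> real n - 2 * (2 * real k + real g - 1)"
      using e g by (intro diff_left_mono mult_right_mono) auto
    finally have "e * (real n - real I) / real n \<le> (real n - 2 * (2 * real k + real g - 1)) / real n"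
      using n by (intro divide_right_mono) auto
    then show ?thesis using n by (simp add: diff_divide_distrib)
  qed
  moreover have "ln (real n) - ln (real n - real I) \<le> harmonic_tail n I"
    using rpos by (intro harmonic_tail_ge) auto
  moreover have "(2 * real k + 1) / 2 / (real n - real I) \<le> (2 * real k + 1) / 2 / (real n / 4)"
    using r4 rpos n by (intro divide_left_mono) auto
  moreover have "(2 * real k + 1) / 2 / (real n / 4) = (4 * real k + 2) / real n"
    using n by (simp add: field_simps)
  moreover have "\<delta> \<le> 2 * (2 * real k + real g - 1) / real n - (4 * real k + 2) / real n"
    unfolding \<delta>_def diff_divide_distrib[symmetric] using g n by (intro divide_right_mono) auto
  ultimately have "\<delta> \<le> harmonic_tail n I - 1 - (2 * real k + 1) / 2 / (real n - real I)"
    by linarith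
  moreover have "3 * (2 * real k + 1) \<le> real n - real I"
    using small r4 of_nat_mono[OF g, where 'a = real] by simp
  ultimately have "1 - real I * (3 / (real n - real I))\<^sup>2 / \<delta>\<^sup>2 \<le>
    success_prob n (edge_connected_family n (2 * k + 1)) (circulant_strategy n k) (k * n + I)"
    using k rpos \<delta>0 by (intro success_prob_ge) auto
  moreover have "real I * (3 / (real n - real I))\<^sup>2 / \<delta>\<^sup>2 \<le> real n * (12 / real n)\<^sup>2 / \<delta>\<^sup>2"
  proof (intro divide_right_mono mult_mono power_mono)
    show "3 / (real n - real I) \<le> 12 / real n"
      using r4 n rpos by (simp add: field_simps)
  qed (use n rpos in auto)
  moreover have "real n * (12 / real n)\<^sup>2 / \<delta>\<^sup>2 = 144 * real n / (real g)\<^sup>2"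
    using n g by (simp add: \<delta>_def field_simps power2_eq_square)
  ultimately show ?thesis by linarith
qed

section \<open>Transfer to the optimal hitting time and passage to the limit\<close>

text \<open>A bound for all strategies bounds their maximum, the probability of T \<le> m; on the
  complement T > m \<ge> x.\<close>

lemma is_tau_le_ge:
  assumes tau: "is_tau n \<F> M T" and "n \<ge> 1"
    and b: "\<And>S. S \<in> strategies n \<Longrightarrow> success_prob n \<F> S m \<le> b" and x: "x \<le> real m"
  shows "1 - b \<le> measure M {\<omega> \<in> space M. ereal x \<le> ereal_of_enat (T \<omega>)}"
proof -
  interpret prob_space M using tau by (simp add: is_tau_def)
  have T: "T \<in> M \<rightarrow>\<^sub>M count_space UNIV" using tau by (simp add: is_tau_def)
  have ev: "{\<omega> \<in> space M. R (T \<omega>)} \<in> events" for R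
    using measurable_sets[OF T, of "Collect R"] by (simp add: vimage_def Int_def conj_commute)
  have "prob {\<omega> \<in> space M. T \<omega> \<le> enat m} = (MAX S\<in>strategies n. success_prob n \<F> S m)"
    using tau by (simp add: is_tau_def)
  also have "\<dots> \<le> b"
    using b strategies_nonempty[OF \<open>n \<ge> 1\<close>] finite_success_probs[OF \<open>n \<ge> 1\<close>]
    by (subst Max_le_iff) auto
  finally have "prob {\<omega> \<in> space M. T \<omega> \<le> enat m} \<le> b" .
  moreover have "prob (space M) \<le> prob ({\<omega> \<in> space M. ereal x \<le> ereal_of_enat (T \<omega>)} \<union>
      {\<omega> \<in> space M. T \<omega> \<le> enat m})"
  proof (rule finite_measure_mono)
    have "ereal x \<le> ereal_of_enat t \<or> t \<le> enat m" for t
      using x by (cases t) auto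
    then show "space M \<subseteq> {\<omega> \<in> space M. ereal x \<le> ereal_of_enat (T \<omega>)} \<union>
      {\<omega> \<in> space M. T \<omega> \<le> enat m}" by blast
  qed (intro sets.Un ev)
  moreover have "\<dots> \<le> prob {\<omega> \<in> space M. ereal x \<le> ereal_of_enat (T \<omega>)} +
      prob {\<omega> \<in> space M. T \<omega> \<le> enat m}"
    by (intro measure_Un_le ev)
  ultimately show ?thesis by (simp add: prob_space)
qed

lemma is_tau_ge_success_prob:
  assumes tau: "is_tau n \<F> M T" and "n \<ge> 1" "S \<in> strategies n" and x: "real m \<le> x"
  shows "success_prob n \<F> S m \<le> measure M {\<omega> \<in> space M. ereal_of_enat (T \<omega>) \<le> ereal x}"
proof -
  interpret prob_space M using tau by (simp add: is_tau_def)
  have T: "T \<in> M \<rightarrow>\<^sub>M count_space UNIV" using tau by (simp add: is_tau_def)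
  have ev: "{\<omega> \<in> space M. R (T \<omega>)} \<in> events" for R
    using measurable_sets[OF T, of "Collect R"] by (simp add: vimage_def Int_def conj_commute)
  have "success_prob n \<F> S m \<le> (MAX S\<in>strategies n. success_prob n \<F> S m)"
    using assms(3) finite_success_probs[OF \<open>n \<ge> 1\<close>] by (intro Max_ge) auto
  also have "\<dots> = prob {\<omega> \<in> space M. T \<omega> \<le> enat m}"
    using tau by (simp add: is_tau_def)
  also have "\<dots> \<le> prob {\<omega> \<in> space M. ereal_of_enat (T \<omega>) \<le> ereal x}"
  proof (rule finite_measure_mono)
    have "t \<le> enat m \<Longrightarrow> ereal_of_enat t \<le> ereal x" for t
      using x by (cases t) auto
    then show "{\<omega> \<in> space M. T \<omega> \<le> enat m} \<subseteq> {\<omega> \<in> space M. ereal_of_enat (T \<omega>) \<le> ereal x}"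
      by blast
  qed (rule ev)
  finally show ?thesis .
qed

theorem theorem9p1:
  fixes k f :: "nat \<Rightarrow> nat"
    and M :: "nat \<Rightarrow> 'a measure"
    and \<tau> :: "nat \<Rightarrow> 'a \<Rightarrow> enat"
  assumes k_ge: "\<And>n. n \<ge> 12 \<Longrightarrow> 2 \<le> k n"
    and k_le: "\<And>n. n \<ge> 12 \<Longrightarrow> real (k n) \<le> real n / 2 - 1"
    and f: "(\<lambda>n. real (f n)) \<in> \<omega>(\<lambda>n. sqrt (real n))"
    and tau: "\<And>n. n \<ge> 12 \<Longrightarrow> is_tau n (edge_connected_family n (2 * k n + 1)) (M n) (\<tau> n)"
  shows "((\<lambda>n. measure (M n) {\<omega> \<in> space (M n).
             ereal ((real (k n) + 1 - 1 / exp 1) * real n - real (f n)) \<le> ereal_of_enat (\<tau> n \<omega>)})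
           \<longlonglongrightarrow> 1) \<and>
         ((\<lambda>n. real (k n)) \<in> o(\<lambda>n. real n) \<longrightarrow>
          (\<lambda>n. measure (M n) {\<omega> \<in> space (M n).
             ereal_of_enat (\<tau> n \<omega>) \<le>
               ereal ((real (k n) + 1 - 1 / exp 1) * real n + real (f n) + 2 * real (k n))})
           \<longlonglongrightarrow> 1)"
proof -
  have le_1: "measure (M n) A \<le> 1" if "n \<ge> 12" for n A
    using tau[OF that] by (auto simp: is_tau_def intro: prob_space.prob_le_1)
  \<comment> \<open>The growth of \<open>f\<close> makes the error terms of order n / f^2
    vanish.\<close>
  have "(\<lambda>n. sqrt (real n) / real (f n)) \<longlonglongrightarrow> 0"
    using f by (intro smalloD_tendsto) (simp add: smallomega_iff_smallo)
  then have "(\<lambda>n. (sqrt (real n) / real (f n))\<^sup>2) \<longlonglongrightarrow> 0\<^sup>2"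
    by (rule tendsto_power)
  then have f2: "(\<lambda>n. real n / (real (f n))\<^sup>2) \<longlonglongrightarrow> 0"
    by (simp add: power_divide)
  have "eventually (\<lambda>n. norm (real (f n)) \<ge> 1 * norm (sqrt (real n))) sequentially"
    using f by (rule landau_omega.smallD) simp
  then have f4: "eventually (\<lambda>n. f n \<ge> 4) sequentially"
    using eventually_ge_at_top[of 16]
  proof eventually_elim
    case (elim n)
    have "sqrt 16 \<le> sqrt (real n)" using elim(2) by (intro real_sqrt_le_mono) auto
    then show ?case using elim(1) by simp
  qed
  have lower: "(\<lambda>n. measure (M n) {\<omega> \<in> space (M n).
      ereal ((real (k n) + 1 - 1 / exp 1) * real n - real (f n)) \<le> ereal_of_enat (\<tau> n \<omega>)})
      \<longlonglongrightarrow> 1" (is "?P \<longlonglongrightarrow> 1")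
  proof (rule tendsto_sandwich)
    show "(\<lambda>n. 1 - 36 * (real n / (real (f n))\<^sup>2)) \<longlonglongrightarrow> 1"
      using tendsto_diff[OF tendsto_const tendsto_mult_right_zero[OF f2]] by simp
    show "eventually (\<lambda>n. 1 - 36 * (real n / (real (f n))\<^sup>2) \<le> ?P n) sequentially"
      using f4 eventually_ge_at_top[of 12]
    proof eventually_elim
      case (elim n)
      define I where "I = nat \<lceil>(1 - 1 / exp 1) * real n - real (f n)\<rceil>"
      show ?case
      proof (rule is_tau_le_ge[OF tau])
        show "n \<ge> 12" "n \<ge> 1" using elim by auto
        show "success_prob n (edge_connected_family n (2 * k n + 1)) S (k n * n + I)
            \<le> 36 * (real n / (real (f n))\<^sup>2)" for S
          using success_prob_lower_bound[OF _ elim(1) I_def, of "k n" S] elim(2) by simp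
        have "(1 - 1 / exp 1) * real n - real (f n) \<le> real I"
          unfolding I_def by linarith
        then show "(real (k n) + 1 - 1 / exp 1) * real n - real (f n) \<le> real (k n * n + I)"
          by (simp add: algebra_simps)
      qed
    qed
    show "eventually (\<lambda>n. ?P n \<le> 1) sequentially"
      using eventually_ge_at_top[of 12] by eventually_elim (rule le_1)
  qed (rule tendsto_const)
  have upper: "(\<lambda>n. measure (M n) {\<omega> \<in> space (M n). ereal_of_enat (\<tau> n \<omega>) \<le>
      ereal ((real (k n) + 1 - 1 / exp 1) * real n + real (f n) + 2 * real (k n))}) \<longlonglongrightarrow> 1"
    (is "?P \<longlonglongrightarrow> 1") if ko: "(\<lambda>n. real (k n)) \<in> o(\<lambda>n. real n)"
  proof (rule tendsto_sandwich)
    \<comment> \<open>The first term is the error for \<open>g = f n\<close>, the second for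
      \<open>g = n div 40\<close>, where g \<ge> n / 80 and 80^2 = 6400.\<close>
    define b where "b n = 144 * (real n / (real (f n))\<^sup>2) + 144 * 6400 * (1 / real n)" for n
    have "(\<lambda>n. 1 - b n) \<longlonglongrightarrow> 1 - (144 * 0 + 144 * 6400 * 0)"
      unfolding b_def by (intro tendsto_intros f2 lim_1_over_n)
    then show "(\<lambda>n. 1 - b n) \<longlonglongrightarrow> 1" by simp
    have "eventually (\<lambda>n. norm (real (k n)) \<le> 1 / 80 * norm (real n)) sequentially"
      using ko by (rule landau_o.smallD) simp
    then show "eventually (\<lambda>n. 1 - b n \<le> ?P n) sequentially"
      using f4 eventually_ge_at_top[of 160]
    proof eventually_elim
      case (elim n)
      \<comment> \<open>\<open>f\<close> may be far larger than n, whereas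
        \<open>success_prob_upper_bound\<close> needs 2 k + g \<le> n / 20. Capping \<open>g\<close>
        at n / 40 leaves n / 40 for 2 k, and n \<ge> 160 keeps g \<ge> 4.\<close>
      define g where "g = min (f n) (n div 40)"
      define I where "I = nat \<lfloor>(1 - 1 / exp 1) * real n + 2 * real (k n) + real g\<rfloor>"
      have n: "n \<ge> 12" "n \<ge> 1" using elim by auto
      have g: "g \<ge> 4" "g \<le> f n" "real g \<le> real n / 40"
        using elim by (auto simp: g_def min_def)
      have "144 * real n / (real g)\<^sup>2 \<le> b n"
      proof (cases "f n \<le> n div 40")
        case True
        then show ?thesis by (simp add: g_def b_def min_def)
      next
        case False
        then have "real g \<ge> real n / 80" using elim by (simp add: g_def min_def)
        then have "144 * real n / (real g)\<^sup>2 \<le> 144 * real n / (real n / 80)\<^sup>2"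
          using n by (intro divide_left_mono power_mono mult_pos_pos) auto
        also have "\<dots> = 144 * 6400 * (1 / real n)"
          using n by (simp add: field_simps power2_eq_square)
        also have "\<dots> \<le> b n" by (simp add: b_def)
        finally show ?thesis .
      qed
      then have "1 - b n \<le> 1 - 144 * real n / (real g)\<^sup>2" by simp
      also have "\<dots> \<le> success_prob n (edge_connected_family n (2 * k n + 1))
          (circulant_strategy n (k n)) (k n * n + I)"
        using k_ge[OF n(1)] g(1) _ I_def
      proof (rule success_prob_upper_bound)
        show "2 * real (k n) + real g \<le> real n / 20" using elim(1) g(3) by simp
      qed
      also have "\<dots> \<le> ?P n"
      proof (rule is_tau_ge_success_prob[OF tau[OF n(1)] n(2) circulant_strategy_in[OF n(2)]])
        have "0 \<le> (1 - 1 / exp 1) * real n" by simp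
        then have "real I \<le> (1 - 1 / exp 1) * real n + 2 * real (k n) + real g"
          unfolding I_def by linarith
        then show "real (k n * n + I) \<le>
            (real (k n) + 1 - 1 / exp 1) * real n + real (f n) + 2 * real (k n)"
          using g(2) by (simp add: algebra_simps)
      qed
      finally show ?case .
    qed
    show "eventually (\<lambda>n. ?P n \<le> 1) sequentially"
      using eventually_ge_at_top[of 12] by eventually_elim (rule le_1)
  qed (rule tendsto_const)
  from lower upper show ?thesis by blast
qed

end
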